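(* Let $\mathcal{A}$ be a sharp arrangement in $\mathbb{R}^d$. Then for any very generic vector $v\in\mathbb{R}^d$ with respect to $\mathcal{A}$, \[P_{\mathcal{A}}(z)=\sum_{C\subseteq\mathsf{h}_v^-}z^{\operatorname{des}_{\preceq_{B(v)}}(C)},\] where the sum is over all regions $C$ of $\mathcal{A}$ contained in $\mathsf{h}_v^-=\{x:\langle x,v\rangle\le 0\}$, $B(v)$ is the unique region containing $v$, and $\operatorname{des}_{\preceq_{B(v)}}(C)$ is the number of regions covered by $C$ in the weak order with base region $B(v)$.
   Context: $\mathcal{A}$ is a finite set of linear hyperplanes in $\mathbb{R}^d$. Flats: intersections of subsets of $\mathcal{A}$, lattice $\mathcal{L}[\mathcal{A}]$ under inclusion with minimum $\bot=\bigcap\mathcal{A}$, Möbius function $\mu$; $P_{\mathcal{A}}(z)=\sum_{\mathrm{X}}|\mu(\bot,\mathrm{X})|(z-1)^{\operatorname{codim}\mathrm{X}}$. Regions: closures of connected components of the complement of $\bigcup\mathcal{A}$. $\mathcal{A}$ is simplicial if each region contains exactly $\operatorname{rank}(\mathcal{A})$ faces of rank one. $\mathcal{A}$ is sharp if it is simplicial and, for every region $C$ (of the essentialization, i.e. the intersection of $\mathcal{A}$ with $\bot^\perp$), the angle between any two facets of $C$ is at most $\pi/2$; equivalently, if $n_1,\dots,n_d$ are inward normals of the facets of a region of the essential arrangement, $\langle n_i,n_j\rangle\le 0$ for $i\neq j$. A hyperplane is generic w.r.t. $\mathcal{A}$ if it contains $\bot$ and no other flat; a vector $v$ is very generic if it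 lies in no hyperplane of $\mathcal{A}$ and the hyperplane $v^\perp$ is generic. Weak order with base region $B$: $C\preceq_B D$ iff every hyperplane separating $B$ and $C$ also separates $B$ and $D$. *)

theory Defs
  imports "HOL-Analysis.Analysis" "HOL-Computational_Algebra.Polynomial"
begin

definition linear_hyperplane :: "'a::euclidean_space set \<Rightarrow> bool" where
  "linear_hyperplane H \<longleftrightarrow> (\<exists>a. a \<noteq> 0 \<and> H = {x. a \<bullet> x = 0})"

definition arrangement :: "'a::euclidean_space set set \<Rightarrow> bool" where
  "arrangement A \<longleftrightarrow> finite A \<and> (\<forall>H\<in>A. linear_hyperplane H)"

definition flats :: "'a::euclidean_space set set \<Rightarrow> 'a set set" where
  "flats A = {\<Inter>S | S. S \<subseteq> A}"

definition bottom_flat :: "'a::euclidean_space set set \<Rightarrow> 'a set" where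
  "bottom_flat A = \<Inter>A"

definition codim :: "'a::euclidean_space set \<Rightarrow> nat" where
  "codim X = DIM('a) - dim X"

definition arr_rank :: "'a::euclidean_space set set \<Rightarrow> nat" where
  "arr_rank A = codim (bottom_flat A)"

function mobius :: "'a set set \<Rightarrow> 'a set \<Rightarrow> 'a set \<Rightarrow> int" where
  "mobius L x y =
     (if x = y then 1
      else if finite L \<and> y \<in> L \<and> x \<subseteq> y
        then - (\<Sum>z\<in>{z\<in>L. x \<subseteq> z \<and> z \<subset> y}. mobius L x z)
      else 0)"
  by pat_completeness auto
termination
proof (relation "Wellfounded.measure (\<lambda>(L, x, y). card {w\<in>L. w \<subset> y})")
  show "wf (Wellfounded.measure (\<lambda>(L, x, y). card {w\<in>L. w \<subset> y}))" by simp
next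
  fix L :: "'a set set" and x y z
  assume h: "\<not> x = y" "finite L \<and> y \<in> L \<and> x \<subseteq> y" "z \<in> {z\<in>L. x \<subseteq> z \<and> z \<subset> y}"
  have "{w\<in>L. w \<subset> z} \<subset> {w\<in>L. w \<subset> y}" using h by auto
  moreover have "finite {w\<in>L. w \<subset> y}" using h by auto
  ultimately show "((L, x, z), L, x, y) \<in> Wellfounded.measure (\<lambda>(L, x, y). card {w\<in>L. w \<subset> y})"
    by (simp add: psubset_card_mono)
qed

declare mobius.simps [simp del]

definition arr_poly :: "'a::euclidean_space set set \<Rightarrow> int poly" where
  "arr_poly A = (\<Sum>X\<in>flats A.
       smult \<bar>mobius (flats A) (bottom_flat A) X\<bar> ([:-1, 1:] ^ codim X))"

text \<open>Regions of the arrangement restricted to an ambient set S (S = UNIV: the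
  arrangement itself; S = orthogonal complement of the bottom flat: the essentialization):
  closures of connected components of S minus the union of the hyperplanes.\<close>
definition regions_within :: "'a::euclidean_space set \<Rightarrow> 'a set set \<Rightarrow> 'a set set" where
  "regions_within S A =
     {closure (connected_component_set (S - \<Union>A) x) | x. x \<in> S - \<Union>A}"

definition regions :: "'a::euclidean_space set set \<Rightarrow> 'a set set" where
  "regions A = regions_within UNIV A"

definition ess_regions :: "'a::euclidean_space set set \<Rightarrow> 'a set set" where
  "ess_regions A = regions_within (orthogonal_comp (bottom_flat A)) A"

definition rank_one_faces :: "'a::euclidean_space set set \<Rightarrow> 'a set \<Rightarrow> 'a set set" where
  "rank_one_faces A C = {F. F face_of C \<and> aff_dim F = aff_dim (bottom_flat A) + 1}"

definition simplicial :: "'a::euclidean_space set set \<Rightarrow> bool" where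
  "simplicial A \<longleftrightarrow> (\<forall>C\<in>regions A. card (rank_one_faces A C) = arr_rank A)"

definition facets :: "'a::euclidean_space set \<Rightarrow> 'a set set" where
  "facets C = {F. F face_of C \<and> aff_dim F = aff_dim C - 1}"

definition inward_normal :: "'a::euclidean_space set \<Rightarrow> 'a set \<Rightarrow> 'a set \<Rightarrow> 'a \<Rightarrow> bool" where
  "inward_normal W C F n \<longleftrightarrow> n \<in> W \<and> n \<noteq> 0 \<and> (\<forall>x\<in>F. n \<bullet> x = 0) \<and> (\<forall>x\<in>C. 0 \<le> n \<bullet> x)"

definition sharp :: "'a::euclidean_space set set \<Rightarrow> bool" where
  "sharp A \<longleftrightarrow> simplicial A \<and>
     (\<forall>C\<in>ess_regions A. \<forall>F1\<in>facets C. \<forall>F2\<in>facets C. \<forall>n1 n2.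
        F1 \<noteq> F2 \<longrightarrow> inward_normal (orthogonal_comp (bottom_flat A)) C F1 n1
          \<longrightarrow> inward_normal (orthogonal_comp (bottom_flat A)) C F2 n2 \<longrightarrow> n1 \<bullet> n2 \<le> 0)"

definition generic_hyperplane :: "'a::euclidean_space set set \<Rightarrow> 'a set \<Rightarrow> bool" where
  "generic_hyperplane A H \<longleftrightarrow> linear_hyperplane H \<and> bottom_flat A \<subseteq> H \<and>
     (\<forall>X\<in>flats A. X \<subseteq> H \<longrightarrow> X = bottom_flat A)"

definition very_generic :: "'a::euclidean_space set set \<Rightarrow> 'a \<Rightarrow> bool" where
  "very_generic A v \<longleftrightarrow> v \<notin> \<Union>A \<and> generic_hyperplane A {x. x \<bullet> v = 0}"

definition region_of :: "'a::euclidean_space set set \<Rightarrow> 'a \<Rightarrow> 'a set" where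
  "region_of A v = (THE C. C \<in> regions A \<and> v \<in> C)"

definition separates :: "'a::euclidean_space set \<Rightarrow> 'a set \<Rightarrow> 'a set \<Rightarrow> bool" where
  "separates H B C \<longleftrightarrow>
     (\<exists>a. H = {x. a \<bullet> x = 0} \<and> (\<forall>x\<in>B. 0 \<le> a \<bullet> x) \<and> (\<forall>x\<in>C. a \<bullet> x \<le> 0))"

definition weak_le :: "'a::euclidean_space set set \<Rightarrow> 'a set \<Rightarrow> 'a set \<Rightarrow> 'a set \<Rightarrow> bool" where
  "weak_le A B C D \<longleftrightarrow> (\<forall>H\<in>A. separates H B C \<longrightarrow> separates H B D)"

definition covers :: "'a::euclidean_space set set \<Rightarrow> 'a set \<Rightarrow> 'a set \<Rightarrow> 'a set \<Rightarrow> bool" where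
  "covers A B C D \<longleftrightarrow> C \<in> regions A \<and> D \<in> regions A \<and>
     weak_le A B D C \<and> D \<noteq> C \<and>
     \<not> (\<exists>E\<in>regions A. weak_le A B D E \<and> weak_le A B E C \<and> E \<noteq> D \<and> E \<noteq> C)"

definition des :: "'a::euclidean_space set set \<Rightarrow> 'a set \<Rightarrow> 'a set \<Rightarrow> nat" where
  "des A B C = card {D \<in> regions A. covers A B C D}"

end

(* Sharpness says that the inward normals of the walls of every region are pairwise obtuse, hence
   linearly independent.  Substituting z = 1 + t, a term z^des(C) expands into a sum over the subsets
   S of the descent walls of C, that is, over the faces F of C all of whose walls are descents, with
   weight t^codim(F).  A face F determines C as the region entered from F in direction - v, and by
   obtuseness C lies in the half-space of v as soon as F does: orthogonal projection of a point of C
   to span(F) stays in the closure of F and only subtracts a nonnegative combination of wall normals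
   on which v is negative.  So the right-hand side counts the faces contained in the half-space by
   codimension.  By an Euler characteristic argument their signed count below a flat X vanishes unless
   X is the bottom flat, so the number of such faces spanning X is the absolute value of the Moebius
   function. *)

theory Submission
  imports Defs
begin

text \<open>The Euler characteristic is a finite combinatorial one: a relatively open cell inside
  the closed half-space weighs (-1)^dim, and this weight is additive under cutting by a hyperplane.
  The total over the cells of a flat X is thus the weight of X as a single cell, and a subspace lies
  in the half-space only if it is orthogonal to v. Up to sign this is the recursion that defines the
  Moebius function.

  Obtuseness gives two things: every set of walls of a chamber cuts out a nonempty face whose
  codimension is the size of the set, and the coefficients in the projection are nonnegative. Both
  rest on pairing a combination of normals with its own negative part.

  Regions are given topologically, sharpness by facets of the essentialization, descents by covers
  of an order. All are translated into signs of normals that are positive on v, with walls taken as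
  irredundant inequalities.\<close>

section \<open>Small perturbations and one-sided limits\<close>

lemma sgn_perturb:
  fixes b :: "'i \<Rightarrow> 'a::real_inner"
  assumes "finite I"
  obtains \<delta> where "\<delta> > 0"
    "\<And>t i. \<bar>t\<bar> \<le> \<delta> \<Longrightarrow> i \<in> I \<Longrightarrow> b i \<bullet> p \<noteq> 0 \<Longrightarrow> sgn (b i \<bullet> (p + t *\<^sub>R y)) = sgn (b i \<bullet> p)"
proof -
  have "\<forall>\<^sub>F t in nhds (0::real). b i \<bullet> p \<noteq> 0 \<longrightarrow> sgn (b i \<bullet> (p + t *\<^sub>R y)) = sgn (b i \<bullet> p)" for i
  proof -
    have lim: "((\<lambda>t. b i \<bullet> (p + t *\<^sub>R y)) \<longlongrightarrow> b i \<bullet> (p + 0 *\<^sub>R y)) (nhds (0::real))"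
      by (intro tendsto_intros filterlim_ident)
    consider "b i \<bullet> p = 0" | "0 < b i \<bullet> p" | "b i \<bullet> p < 0" by linarith
    then show ?thesis
    proof cases
      case 2
      then have "\<forall>\<^sub>F t in nhds (0::real). 0 < b i \<bullet> (p + t *\<^sub>R y)"
        using order_tendstoD(1)[OF lim, of 0] by simp
      then show ?thesis by eventually_elim (use 2 in simp)
    next
      case 3
      then have "\<forall>\<^sub>F t in nhds (0::real). b i \<bullet> (p + t *\<^sub>R y) < 0"
        using order_tendstoD(2)[OF lim, of 0] by simp
      then show ?thesis by eventually_elim (use 3 in simp)
    qed simp
  qed
  then have "\<forall>\<^sub>F t in nhds (0::real). \<forall>i\<in>I. b i \<bullet> p \<noteq> 0 \<longrightarrow>
      sgn (b i \<bullet> (p + t *\<^sub>R y)) = sgn (b i \<bullet> p)"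
    using assms by (simp add: eventually_ball_finite)
  then obtain d where "d > 0" and d: "\<And>t. \<bar>t\<bar> < d \<Longrightarrow> \<forall>i\<in>I. b i \<bullet> p \<noteq> 0 \<longrightarrow>
      sgn (b i \<bullet> (p + t *\<^sub>R y)) = sgn (b i \<bullet> p)"
    unfolding eventually_nhds_metric by (auto simp: dist_real_def)
  show ?thesis
  proof
    show "d / 2 > 0" using \<open>d > 0\<close> by simp
    fix t i assume "\<bar>t\<bar> \<le> d / 2" "i \<in> I" "b i \<bullet> p \<noteq> 0"
    then show "sgn (b i \<bullet> (p + t *\<^sub>R y)) = sgn (b i \<bullet> p)" using d[of t] \<open>d > 0\<close> by auto
  qed
qed

text \<open>Stands in for closure arguments: a point that satisfies only weak inequalities is pushed
  by t into the open set, and the bound found there survives t -> 0.\<close>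

lemma affine_nonneg_at_zero:
  fixes b c :: real
  assumes "\<And>t. 0 < t \<Longrightarrow> t < 1 \<Longrightarrow> 0 \<le> b + t * c"
  shows "0 \<le> b"
proof (rule tendsto_lowerbound)
  have "((\<lambda>t. b + t * c) \<longlongrightarrow> b + 0 * c) (at_right 0)"
    by (intro tendsto_intros)
  then show "((\<lambda>t. b + t * c) \<longlongrightarrow> b) (at_right 0)" by simp
  show "\<forall>\<^sub>F t in at_right 0. 0 \<le> b + t * c"
    using eventually_at_right_real[of 0 "1::real"] by (auto elim!: eventually_mono intro: assms)
qed simp

subsection \<open>Pairwise obtuse vectors\<close>

text \<open>Write the combination as u = P - u', with P and u' its positive and negative parts. They
  have disjoint supports, so obtuseness gives P . u' <= 0, while the last inequality hypothesis
  gives u . u' >= 0; hence u' . u' <= 0. Pairing u' = 0 with x, on which all normals are positive,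
  then kills each negative coefficient without presupposing independence.\<close>

lemma obtuse_coeff_nonneg:
  fixes N :: "'a::real_inner set"
  assumes "finite N"
    and obtuse: "\<And>m n. m \<in> N \<Longrightarrow> n \<in> N \<Longrightarrow> m \<noteq> n \<Longrightarrow> m \<bullet> n \<le> 0"
    and pos: "\<And>n. n \<in> N \<Longrightarrow> 0 < n \<bullet> x"
    and nonneg: "\<And>n. n \<in> N \<Longrightarrow> 0 \<le> n \<bullet> (\<Sum>m\<in>N. e m *\<^sub>R m)"
    and "n \<in> N"
  shows "0 \<le> e n"
proof -
  define u where "u = (\<Sum>m\<in>N. e m *\<^sub>R m)"
  define u' where "u' = (\<Sum>m\<in>N. max 0 (- e m) *\<^sub>R m)"
  have eq: "u + u' = (\<Sum>m\<in>N. max 0 (e m) *\<^sub>R m)"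
    unfolding u_def u'_def sum.distrib[symmetric] scaleR_left_distrib[symmetric]
    by (intro sum.cong refl) (simp add: max_def)
  have "(u + u') \<bullet> u' = (\<Sum>m\<in>N. \<Sum>k\<in>N. max 0 (e m) * max 0 (- e k) * (m \<bullet> k))"
    unfolding eq unfolding u'_def
    by (simp add: inner_sum_left inner_sum_right sum_distrib_left mult_ac) (rule sum.swap)
  also have "\<dots> \<le> 0"
  proof (intro sum_nonpos)
    fix m k assume "m \<in> N" "k \<in> N"
    show "max 0 (e m) * max 0 (- e k) * (m \<bullet> k) \<le> 0"
    proof (cases "m = k")
      case True
      then show ?thesis by (simp add: max_def)
    next
      case False
      then show ?thesis using obtuse[OF \<open>m \<in> N\<close> \<open>k \<in> N\<close>] by (intro mult_nonneg_nonpos) auto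
    qed
  qed
  finally have "u \<bullet> u' + u' \<bullet> u' \<le> 0" by (simp add: inner_add_left)
  moreover have "u \<bullet> u' \<ge> 0"
    unfolding u'_def inner_sum_right using nonneg
    by (intro sum_nonneg) (simp add: u_def inner_commute)
  ultimately have "u' = 0" by (metis inner_gt_zero_iff add_nonneg_pos not_le)
  then have "(\<Sum>m\<in>N. max 0 (- e m) * (m \<bullet> x)) = 0"
    unfolding u'_def by (metis (no_types, lifting) inner_scaleR_left inner_sum_left inner_zero_left sum.cong)
  then have "max 0 (- e n) * (n \<bullet> x) = 0"
    using \<open>finite N\<close> \<open>n \<in> N\<close> pos by (subst (asm) sum_nonneg_eq_0_iff) (auto intro!: mult_nonneg_nonneg less_imp_le[OF pos])
  then show ?thesis using pos[OF \<open>n \<in> N\<close>] by (simp add: max_def split: if_splits)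
qed

text \<open>A linear relation and its negation both satisfy \<open>obtuse_coeff_nonneg\<close>, so
  each coefficient is both >= 0 and <= 0.\<close>

lemma obtuse_independent:
  fixes N :: "'a::real_inner set"
  assumes "finite N"
    and "\<And>m n. m \<in> N \<Longrightarrow> n \<in> N \<Longrightarrow> m \<noteq> n \<Longrightarrow> m \<bullet> n \<le> 0"
    and "\<And>n. n \<in> N \<Longrightarrow> 0 < n \<bullet> x"
  shows "independent N"
proof -
  have "e n = 0" if sum: "(\<Sum>m\<in>N. e m *\<^sub>R m) = 0" and "n \<in> N" for e n
  proof -
    have "0 \<le> e n" using obtuse_coeff_nonneg[OF assms, of e n] that by simp
    moreover have "0 \<le> - e n"
      using obtuse_coeff_nonneg[OF assms, of "\<lambda>m. - e m" n] that by (simp add: sum_negf)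
    ultimately show ?thesis by simp
  qed
  then show ?thesis using \<open>finite N\<close> by (auto simp: dependent_finite)
qed

text \<open>Here p is the component of y orthogonal to span N. The other component has the same
  inner products with N as y has, so \<open>obtuse_coeff_nonneg\<close> applies to its
  coefficients.\<close>

lemma obtuse_projection:
  fixes N :: "'a::euclidean_space set"
  assumes "finite N"
    and "\<And>m n. m \<in> N \<Longrightarrow> n \<in> N \<Longrightarrow> m \<noteq> n \<Longrightarrow> m \<bullet> n \<le> 0"
    and "\<And>n. n \<in> N \<Longrightarrow> 0 < n \<bullet> x"
    and nonneg: "\<And>n. n \<in> N \<Longrightarrow> 0 \<le> n \<bullet> y"
  obtains e p where "y = (\<Sum>m\<in>N. e m *\<^sub>R m) + p"
    "\<And>m. m \<in> N \<Longrightarrow> 0 \<le> e m" "\<And>m. m \<in> N \<Longrightarrow> m \<bullet> p = 0"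
proof -
  obtain u p where u: "u \<in> span N" and p: "\<And>w. w \<in> span N \<Longrightarrow> orthogonal p w" and y: "y = u + p"
    using orthogonal_subspace_decomp_exists[of N y] by blast
  obtain e where e: "u = (\<Sum>m\<in>N. e m *\<^sub>R m)"
    using u span_finite[OF \<open>finite N\<close>] by auto
  have np: "m \<bullet> p = 0" if "m \<in> N" for m
    using p[of m] that by (simp add: orthogonal_def inner_commute span_base)
  have "0 \<le> e m" if "m \<in> N" for m
  proof (rule obtuse_coeff_nonneg[OF assms(1-3) _ that, where e = e])
    fix n assume "n \<in> N"
    then show "0 \<le> n \<bullet> (\<Sum>m\<in>N. e m *\<^sub>R m)"
      using nonneg[of n] np[of n] unfolding y e by (simp add: inner_add_right)
  qed
  with y e np show ?thesis using that by blast
qed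

subsection \<open>Sign cells and their Euler characteristic in a half-space\<close>

text \<open>Openness is measured in the linear span, one direction at a time and both ways along it.
  This is what is needed to extend a segment slightly beyond its endpoint.\<close>

definition rel_open_cell :: "'a::euclidean_space set \<Rightarrow> bool" where
  "rel_open_cell F \<longleftrightarrow> F \<noteq> {} \<and> convex F \<and>
     (\<forall>x\<in>F. \<forall>y\<in>span F. \<exists>\<epsilon>>0. \<forall>t. \<bar>t\<bar> \<le> \<epsilon> \<longrightarrow> x + t *\<^sub>R y \<in> F)"

lemma rel_open_cellD:
  assumes "rel_open_cell F" "x \<in> F" "y \<in> span F"
  obtains \<epsilon> where "\<epsilon> > 0" "\<And>t. \<bar>t\<bar> \<le> \<epsilon> \<Longrightarrow> x + t *\<^sub>R y \<in> F"
  using assms unfolding rel_open_cell_def by blast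

definition sgn_part :: "'a::euclidean_space \<Rightarrow> real \<Rightarrow> 'a set" where
  "sgn_part b s = {y. sgn (b \<bullet> y) = s}"

lemma mem_sgn_part:
  "y \<in> sgn_part b 0 \<longleftrightarrow> b \<bullet> y = 0"
  "y \<in> sgn_part b 1 \<longleftrightarrow> 0 < b \<bullet> y"
  "y \<in> sgn_part b (- 1) \<longleftrightarrow> b \<bullet> y < 0"
  by (auto simp: sgn_part_def sgn_if)

lemma convex_sgn_part: "convex (sgn_part b s)"
proof -
  consider "s = 0" | "s = 1" | "s = - 1" | "sgn_part b s = {}"
    by (metis (mono_tags, lifting) Collect_empty_eq sgn_part_def sgn_real_def)
  then show ?thesis
  proof cases
    case 1
    then have "sgn_part b s = {y. b \<bullet> y = 0}" by (auto simp: mem_sgn_part)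
    then show ?thesis by (simp add: convex_hyperplane)
  next
    case 2
    then have "sgn_part b s = {y. b \<bullet> y > 0}" by (auto simp: mem_sgn_part)
    then show ?thesis by (simp add: convex_halfspace_gt)
  next
    case 3
    then have "sgn_part b s = {y. b \<bullet> y < 0}" by (auto simp: mem_sgn_part)
    then show ?thesis by (simp add: convex_halfspace_lt)
  qed simp
qed

lemma span_subset_from_steps:
  assumes "x \<in> span F" "\<epsilon> \<noteq> 0" "x + \<epsilon> *\<^sub>R y \<in> span F"
  shows "y \<in> span F"
proof -
  have "\<epsilon> *\<^sub>R y \<in> span F" using span_diff[OF assms(3,1)] by simp
  then show ?thesis using assms(2) by (metis scaleR_scaleR span_scale left_inverse scaleR_one)
qed

text \<open>A strict sign condition is open, so small steps in every direction of span F remain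
  possible inside the part.\<close>

lemma span_open_part:
  assumes F: "rel_open_cell F" and x: "x \<in> F \<inter> sgn_part b s" and "s \<noteq> 0"
  shows "span (F \<inter> sgn_part b s) = span F"
proof
  show "span (F \<inter> sgn_part b s) \<subseteq> span F" by (simp add: span_mono)
  have "y \<in> span (F \<inter> sgn_part b s)" if y: "y \<in> span F" for y
  proof -
    obtain e where e: "e > 0" "\<And>t. \<bar>t\<bar> \<le> e \<Longrightarrow> x + t *\<^sub>R y \<in> F"
      using rel_open_cellD[OF F _ y] x by blast
    obtain d where d: "d > 0" "\<And>t. \<bar>t\<bar> \<le> d \<Longrightarrow> b \<bullet> x \<noteq> 0 \<Longrightarrow> sgn (b \<bullet> (x + t *\<^sub>R y)) = sgn (b \<bullet> x)"
      using sgn_perturb[of "{()}" "\<lambda>_. b" x y] by auto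
    have bx: "sgn (b \<bullet> x) = s" using x by (simp add: sgn_part_def)
    then have "b \<bullet> x \<noteq> 0" using \<open>s \<noteq> 0\<close> by auto
    then have "x + min d e *\<^sub>R y \<in> F \<inter> sgn_part b s"
      using e(1) d(1) e(2)[of "min d e"] d(2)[of "min d e"] bx by (simp add: sgn_part_def)
    then show ?thesis
      using span_subset_from_steps[of x _ "min d e" y] x d(1) e(1) by (simp add: span_base)
  qed
  then show "span F \<subseteq> span (F \<inter> sgn_part b s)" by blast
qed

lemma span_zero_part:
  assumes F: "rel_open_cell F" and x: "x \<in> F \<inter> sgn_part b 0"
  shows "span (F \<inter> sgn_part b 0) = span F \<inter> {y. b \<bullet> y = 0}"
proof
  have "subspace (span F \<inter> {y. b \<bullet> y = 0})"
    by (simp add: subspace_inter subspace_hyperplane)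
  moreover have "F \<inter> sgn_part b 0 \<subseteq> span F \<inter> {y. b \<bullet> y = 0}"
    by (auto simp: mem_sgn_part span_base)
  ultimately show "span (F \<inter> sgn_part b 0) \<subseteq> span F \<inter> {y. b \<bullet> y = 0}"
    by (metis span_minimal)
  have "y \<in> span (F \<inter> sgn_part b 0)" if y: "y \<in> span F" "b \<bullet> y = 0" for y
  proof -
    obtain e where e: "e > 0" "\<And>t. \<bar>t\<bar> \<le> e \<Longrightarrow> x + t *\<^sub>R y \<in> F"
      using rel_open_cellD[OF F _ y(1)] x by blast
    then have "x + e *\<^sub>R y \<in> F \<inter> sgn_part b 0"
      using y(2) x by (simp add: mem_sgn_part inner_add_right)
    then show ?thesis
      using span_subset_from_steps[of x _ e y] x e(1) by (simp add: span_base)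
  qed
  then show "span F \<inter> {y. b \<bullet> y = 0} \<subseteq> span (F \<inter> sgn_part b 0)" by blast
qed

lemma dim_subspace_inter_hyperplane:
  fixes V :: "'a::euclidean_space set"
  assumes "subspace V" "y \<in> V" "b \<bullet> y \<noteq> 0"
  shows "dim (V \<inter> {y. b \<bullet> y = 0}) + 1 = dim V"
proof -
  let ?S = "{x + z |x z. x \<in> V \<and> z \<in> {y. b \<bullet> y = 0}}"
  have "b \<noteq> 0" using assms by auto
  have "z \<in> ?S" for z
  proof -
    define c where "c = (b \<bullet> z) / (b \<bullet> y)"
    have "c *\<^sub>R y \<in> V" using assms by (simp add: subspace_scale)
    moreover have "b \<bullet> (z - c *\<^sub>R y) = 0" using assms by (simp add: inner_diff_right c_def)
    moreover have "z = c *\<^sub>R y + (z - c *\<^sub>R y)" by simp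
    ultimately show ?thesis by blast
  qed
  then have "?S = UNIV" by blast
  moreover have "dim ?S + dim (V \<inter> {y. b \<bullet> y = 0}) = dim V + dim {y. b \<bullet> y = 0}"
    using assms by (intro dim_sums_Int) (auto simp: subspace_hyperplane)
  moreover have "dim {y. b \<bullet> y = 0} = DIM('a) - 1" using \<open>b \<noteq> 0\<close> by (rule dim_hyperplane)
  moreover obtain k where "DIM('a) = Suc k" using DIM_positive[where 'a='a] gr0_implies_Suc by blast
  ultimately show ?thesis by simp
qed

text \<open>The empty set gets weight 0, so that all three sign parts of a cut can be summed even
  when some of them are empty.\<close>

definition halfspace_weight :: "'a::euclidean_space \<Rightarrow> 'a set \<Rightarrow> int" where
  "halfspace_weight v F = (if F \<noteq> {} \<and> F \<subseteq> {x. x \<bullet> v \<le> 0} then (- 1) ^ dim F else 0)"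

lemma crossing_point:
  assumes "convex F" "y \<in> F" "z \<in> F" "0 < b \<bullet> y" "b \<bullet> z < 0"
  obtains t where "0 < t" "t < 1" "(1 - t) *\<^sub>R y + t *\<^sub>R z \<in> F \<inter> sgn_part b 0"
proof -
  define t where "t = (b \<bullet> y) / (b \<bullet> y - b \<bullet> z)"
  have t: "0 < t" "t < 1" using assms by (auto simp: t_def field_simps)
  moreover have "b \<bullet> ((1 - t) *\<^sub>R y + t *\<^sub>R z) = 0"
  proof -
    have "b \<bullet> ((1 - t) *\<^sub>R y + t *\<^sub>R z) = b \<bullet> y - t * (b \<bullet> y - b \<bullet> z)"
      by (simp add: inner_add_right algebra_simps)
    then show ?thesis using assms by (simp add: t_def)
  qed
  moreover have "(1 - t) *\<^sub>R y + t *\<^sub>R z \<in> F" using t assms(1-3) by (intro convexD) auto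
  ultimately show ?thesis using that by (simp add: mem_sgn_part)
qed

text \<open>Each point u of the zero part is the limit of points on the segment from u to y, and all
  of these except u have sign s.\<close>

lemma zero_part_halfspace:
  assumes "convex F" "y \<in> F \<inter> sgn_part b s" "s \<noteq> 0" "F \<inter> sgn_part b s \<subseteq> {x. x \<bullet> v \<le> 0}"
  shows "F \<inter> sgn_part b 0 \<subseteq> {x. x \<bullet> v \<le> 0}"
proof
  fix u assume u: "u \<in> F \<inter> sgn_part b 0"
  have "0 \<le> - (u \<bullet> v) + t * (u \<bullet> v - y \<bullet> v)" if t: "0 < t" "t < 1" for t :: real
  proof -
    have "(1 - t) *\<^sub>R u + t *\<^sub>R y \<in> F"
      using assms(1,2) u t by (intro convexD) auto
    moreover have "b \<bullet> ((1 - t) *\<^sub>R u + t *\<^sub>R y) = t * (b \<bullet> y)"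
      using u by (simp add: inner_add_right mem_sgn_part)
    then have "(1 - t) *\<^sub>R u + t *\<^sub>R y \<in> sgn_part b s"
      using assms(2) t(1) by (simp add: sgn_part_def sgn_mult)
    ultimately have "((1 - t) *\<^sub>R u + t *\<^sub>R y) \<bullet> v \<le> 0" using assms(4) by blast
    then show ?thesis by (simp add: algebra_simps)
  qed
  then have "0 \<le> - (u \<bullet> v)" by (rule affine_nonneg_at_zero)
  then show "u \<in> {x. x \<bullet> v \<le> 0}" by simp
qed

text \<open>The real case is a form b with both signs on F. With n = dim F, the two sides have
  dimension n and the zero part n - 1. If both sides lie in the half-space, so does everything, and
  the weights add to (-1)^n. If exactly one side does, the zero part does too and cancels it, as F
  itself does not. If neither does, the zero part does not either. When b has constant sign on F,
  only one part is nonempty.\<close>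

lemma halfspace_weight_split:
  fixes F :: "'a::euclidean_space set"
  assumes F: "rel_open_cell F"
  shows "(\<Sum>s\<in>{0, 1, - 1}. halfspace_weight v (F \<inter> sgn_part b s)) = halfspace_weight v F"
proof -
  let ?h = "{x. x \<bullet> v \<le> 0}"
  have F_ne: "F \<noteq> {}" and "convex F" using F by (auto simp: rel_open_cell_def)
  have sum3: "(\<Sum>s\<in>{0, 1, - 1}. f s) = f 0 + f 1 + f (- 1)" for f :: "real \<Rightarrow> int" by simp
  \<comment> \<open>A form that is weakly one-sided on F and nonzero at some y vanishes nowhere on
    F: at a zero x, a step in direction x - y, away from y, would reach the opposite sign. The
    scalar s treats both signs at once.\<close>
  have no_zero: "b \<bullet> x \<noteq> 0"
    if "x \<in> F" "y \<in> F" "s * (b \<bullet> y) > 0" and one_side: "\<And>z. z \<in> F \<Longrightarrow> s * (b \<bullet> z) \<ge> 0" for x y and s :: real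
  proof
    assume "b \<bullet> x = 0"
    have "x - y \<in> span F" using that by (simp add: span_base span_diff)
    then obtain e where e: "e > 0" "\<And>t. \<bar>t\<bar> \<le> e \<Longrightarrow> x + t *\<^sub>R (x - y) \<in> F"
      using rel_open_cellD[OF F \<open>x \<in> F\<close>] by blast
    then have "s * (b \<bullet> (x + e *\<^sub>R (x - y))) \<ge> 0" using one_side by simp
    then have "e * (s * (b \<bullet> y)) \<le> 0"
      using \<open>b \<bullet> x = 0\<close> by (simp add: inner_add_right inner_diff_right algebra_simps)
    then show False using mult_pos_pos[OF e(1) that(3)] by linarith
  qed
  consider (zero) "\<And>x. x \<in> F \<Longrightarrow> b \<bullet> x = 0"
    | (pos) y where "y \<in> F" "0 < b \<bullet> y" "\<And>z. z \<in> F \<Longrightarrow> b \<bullet> z \<ge> 0"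
    | (neg) y where "y \<in> F" "b \<bullet> y < 0" "\<And>z. z \<in> F \<Longrightarrow> b \<bullet> z \<le> 0"
    | (cut) y z where "y \<in> F" "0 < b \<bullet> y" "z \<in> F" "b \<bullet> z < 0"
    by (meson linorder_less_linear not_less)
  then show ?thesis
  proof cases
    case zero
    then have "F \<inter> sgn_part b 0 = F" "F \<inter> sgn_part b 1 = {}" "F \<inter> sgn_part b (- 1) = {}"
      by (force simp: mem_sgn_part)+
    then show ?thesis unfolding sum3 by (simp add: halfspace_weight_def)
  next
    case pos
    then have "\<And>x. x \<in> F \<Longrightarrow> b \<bullet> x > 0" using no_zero[of _ y 1] by (simp add: order_less_le)
    then have "F \<inter> sgn_part b 0 = {}" "F \<inter> sgn_part b 1 = F" "F \<inter> sgn_part b (- 1) = {}"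
      by (force simp: mem_sgn_part)+
    then show ?thesis unfolding sum3 by (simp add: halfspace_weight_def)
  next
    case neg
    then have "\<And>x. x \<in> F \<Longrightarrow> b \<bullet> x < 0" using no_zero[of _ y "-1"] by (simp add: order_less_le)
    then have "F \<inter> sgn_part b 0 = {}" "F \<inter> sgn_part b 1 = {}" "F \<inter> sgn_part b (- 1) = F"
      by (force simp: mem_sgn_part)+
    then show ?thesis unfolding sum3 by (simp add: halfspace_weight_def)
  next
    case cut
    have y: "y \<in> F \<inter> sgn_part b 1" and z: "z \<in> F \<inter> sgn_part b (- 1)"
      using cut by (auto simp: mem_sgn_part)
    obtain u where u: "u \<in> F \<inter> sgn_part b 0" using crossing_point[OF \<open>convex F\<close> cut(1,3,2,4)] by metis
    have d1: "dim (F \<inter> sgn_part b 1) = dim F" "dim (F \<inter> sgn_part b (- 1)) = dim F"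
      using span_open_part[OF F y] span_open_part[OF F z] by (metis dim_span one_neq_zero neg_equal_0_iff_equal)+
    have "y \<in> span F" "b \<bullet> y \<noteq> 0" using cut by (auto simp: span_base)
    then have d0: "dim F = Suc (dim (F \<inter> sgn_part b 0))"
      using dim_subspace_inter_hyperplane[of "span F" y b] span_zero_part[OF F u] by (metis dim_span subspace_span Suc_eq_plus1)
    have imp1: "F \<inter> sgn_part b 0 \<subseteq> ?h" if "F \<inter> sgn_part b 1 \<subseteq> ?h"
      using zero_part_halfspace[OF \<open>convex F\<close> y _ that] by simp
    have imp2: "F \<inter> sgn_part b 0 \<subseteq> ?h" if "F \<inter> sgn_part b (- 1) \<subseteq> ?h"
      using zero_part_halfspace[OF \<open>convex F\<close> z _ that] by simp
    \<comment> \<open>If both sides had a point with positive v-value, the segment between these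
      points would meet the zero part at a point with positive v-value.\<close>
    have imp3: "F \<inter> sgn_part b 1 \<subseteq> ?h \<or> F \<inter> sgn_part b (- 1) \<subseteq> ?h" if h0: "F \<inter> sgn_part b 0 \<subseteq> ?h"
    proof (rule ccontr)
      assume "\<not> ?thesis"
      then obtain p q where pq: "p \<in> F" "0 < b \<bullet> p" "0 < p \<bullet> v" "q \<in> F" "b \<bullet> q < 0" "0 < q \<bullet> v"
        by (force simp: mem_sgn_part)
      then obtain t where t: "0 < t" "t < 1" "(1 - t) *\<^sub>R p + t *\<^sub>R q \<in> F \<inter> sgn_part b 0"
        using crossing_point[OF \<open>convex F\<close>] by metis
      then have "((1 - t) *\<^sub>R p + t *\<^sub>R q) \<bullet> v \<le> 0" using h0 by blast
      moreover have "((1 - t) *\<^sub>R p + t *\<^sub>R q) \<bullet> v > 0"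
        using t pq by (simp add: inner_add_left add_pos_pos)
      ultimately show False by simp
    qed
    have parts: "F = (F \<inter> sgn_part b 0) \<union> (F \<inter> sgn_part b 1) \<union> (F \<inter> sgn_part b (- 1))"
      by (auto simp: mem_sgn_part)
    have "F \<subseteq> ?h \<longleftrightarrow> F \<inter> sgn_part b 1 \<subseteq> ?h \<and> F \<inter> sgn_part b (- 1) \<subseteq> ?h"
      using parts imp1 by blast
    moreover have "F \<inter> sgn_part b 0 \<subseteq> ?h \<longleftrightarrow> F \<inter> sgn_part b 1 \<subseteq> ?h \<or> F \<inter> sgn_part b (- 1) \<subseteq> ?h"
      using imp1 imp2 imp3 by blast
    moreover have "F \<inter> sgn_part b 0 \<noteq> {}" "F \<inter> sgn_part b 1 \<noteq> {}" "F \<inter> sgn_part b (- 1) \<noteq> {}"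
      using u y z by auto
    ultimately show ?thesis
      unfolding sum3 halfspace_weight_def using d0 d1 F_ne by (simp del: Int_subset_iff)
  qed
qed

section \<open>Sign cells of finitely many linear forms on a subspace\<close>

definition cell :: "'a::euclidean_space set \<Rightarrow> ('i \<Rightarrow> 'a) \<Rightarrow> 'i set \<Rightarrow> 'a \<Rightarrow> 'a set" where
  "cell X a I x = {y \<in> X. \<forall>i\<in>I. sgn (a i \<bullet> y) = sgn (a i \<bullet> x)}"

text \<open>Keeping X separate from the forms makes restriction to a flat a mere change of X: forms
  may vanish on X or become proportional there. The index set is what the induction runs
  over.\<close>

definition cells :: "'a::euclidean_space set \<Rightarrow> ('i \<Rightarrow> 'a) \<Rightarrow> 'i set \<Rightarrow> 'a set set" where
  "cells X a I = cell X a I ` X"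

lemma cell_self: "x \<in> X \<Longrightarrow> x \<in> cell X a I x"
  by (simp add: cell_def)

lemma cell_eq: "y \<in> cell X a I x \<Longrightarrow> cell X a I y = cell X a I x"
  by (auto simp: cell_def)

lemma cells_mem_eq: "F \<in> cells X a I \<Longrightarrow> x \<in> F \<Longrightarrow> F = cell X a I x"
  by (auto simp: cells_def dest: cell_eq)

lemma cell_insert: "cell X a (insert i I) x = cell X a I x \<inter> sgn_part (a i) (sgn (a i \<bullet> x))"
  by (auto simp: cell_def sgn_part_def)

text \<open>Forms vanishing on the cell stay zero along y by hypothesis, and the others keep their
  sign for small t.\<close>

lemma cell_step:
  fixes a :: "'i \<Rightarrow> 'a::euclidean_space"
  assumes "subspace X" "finite I" "z \<in> cell X a I x" "y \<in> X"
    and "\<And>i. i \<in> I \<Longrightarrow> a i \<bullet> x = 0 \<Longrightarrow> a i \<bullet> y = 0"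
  obtains \<epsilon> where "\<epsilon> > 0" "\<And>t. \<bar>t\<bar> \<le> \<epsilon> \<Longrightarrow> z + t *\<^sub>R y \<in> cell X a I x"
proof -
  obtain d where d: "d > 0" "\<And>t i. \<bar>t\<bar> \<le> d \<Longrightarrow> i \<in> I \<Longrightarrow> a i \<bullet> z \<noteq> 0 \<Longrightarrow> sgn (a i \<bullet> (z + t *\<^sub>R y)) = sgn (a i \<bullet> z)"
    using sgn_perturb[OF \<open>finite I\<close>] by metis
  have sz: "sgn (a i \<bullet> z) = sgn (a i \<bullet> x)" if "i \<in> I" for i using assms(3) that by (simp add: cell_def)
  have "sgn (a i \<bullet> (z + t *\<^sub>R y)) = sgn (a i \<bullet> x)" if "\<bar>t\<bar> \<le> d" "i \<in> I" for t i
  proof (cases "a i \<bullet> z = 0")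
    case True
    then have "a i \<bullet> y = 0" using assms(5) sz that by (metis sgn_0_0 sgn_0)
    then show ?thesis using True sz[OF that(2)] by (simp add: inner_add_right)
  qed (use d(2) sz that in simp)
  moreover have "z + t *\<^sub>R y \<in> X" for t
    using assms by (simp add: cell_def subspace_add subspace_scale)
  ultimately show ?thesis using that[OF d(1)] by (simp add: cell_def)
qed

lemma span_cell:
  fixes a :: "'i \<Rightarrow> 'a::euclidean_space"
  assumes "subspace X" "finite I" "x \<in> X"
  shows "span (cell X a I x) = {y \<in> X. \<forall>i\<in>I. a i \<bullet> x = 0 \<longrightarrow> a i \<bullet> y = 0}" (is "_ = ?L")
proof
  have "subspace ?L"
    using assms(1) by (auto simp: subspace_def inner_add_right)
  moreover have "cell X a I x \<subseteq> ?L" by (auto simp: cell_def sgn_0_0)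
  ultimately show "span (cell X a I x) \<subseteq> ?L" by (simp add: span_minimal)
  show "?L \<subseteq> span (cell X a I x)"
  proof
    fix y assume "y \<in> ?L"
    then obtain e where e: "e > 0" "\<And>t. \<bar>t\<bar> \<le> e \<Longrightarrow> x + t *\<^sub>R y \<in> cell X a I x"
      using cell_step[OF assms(1,2) cell_self[OF assms(3)]] by blast
    then have "x + e *\<^sub>R y \<in> cell X a I x" by simp
    then show "y \<in> span (cell X a I x)"
      using span_subset_from_steps[of x _ e y] e(1) span_base[OF cell_self[OF assms(3)]]
      by (metis span_base less_irrefl)
  qed
qed

lemma rel_open_cell_cell:
  fixes a :: "'i \<Rightarrow> 'a::euclidean_space"
  assumes "subspace X" "finite I" "x \<in> X"
  shows "rel_open_cell (cell X a I x)"
  unfolding rel_open_cell_def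
proof (intro conjI ballI)
  show "cell X a I x \<noteq> {}" using cell_self[OF assms(3)] by blast
  have "cell X a I x = X \<inter> (\<Inter>i\<in>I. sgn_part (a i) (sgn (a i \<bullet> x)))"
    by (auto simp: cell_def sgn_part_def)
  then show "convex (cell X a I x)"
    by (simp add: assms(1) subspace_imp_convex convex_Int convex_INT convex_sgn_part)
  fix z y assume "z \<in> cell X a I x" "y \<in> span (cell X a I x)"
  then show "\<exists>\<epsilon>>0. \<forall>t. \<bar>t\<bar> \<le> \<epsilon> \<longrightarrow> z + t *\<^sub>R y \<in> cell X a I x"
    using cell_step[OF assms(1,2), of z a x y] unfolding span_cell[OF assms] by blast
qed

lemma cells_insert:
  "cells X a (insert i I) = (\<lambda>(F, s). F \<inter> sgn_part (a i) s) ` (cells X a I \<times> {0, 1, - 1}) - {{}}"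
  (is "_ = ?R")
proof (intro equalityI subsetI)
  fix G assume "G \<in> cells X a (insert i I)"
  then obtain x where x: "x \<in> X" "G = cell X a (insert i I) x" by (auto simp: cells_def)
  moreover have "sgn (a i \<bullet> x) \<in> {0, 1, - 1}" by (auto simp: sgn_if)
  moreover have "cell X a I x \<in> cells X a I" using x(1) by (simp add: cells_def)
  moreover have "G \<noteq> {}" using cell_self[OF x(1)] x(2) by blast
  ultimately show "G \<in> ?R" unfolding cell_insert by (auto intro!: image_eqI)
next
  fix G assume "G \<in> ?R"
  then obtain F s where F: "F \<in> cells X a I" and G: "G = F \<inter> sgn_part (a i) s" "G \<noteq> {}" by auto
  then obtain x where x: "x \<in> F" "x \<in> sgn_part (a i) s" by auto
  have "F = cell X a I x" using cells_mem_eq[OF F x(1)] .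
  moreover have "x \<in> X" using F x(1) by (auto simp: cells_def cell_def)
  moreover have "s = sgn (a i \<bullet> x)" using x(2) by (simp add: sgn_part_def)
  ultimately show "G \<in> cells X a (insert i I)"
    using G(1) by (auto simp: cells_def cell_insert)
qed

lemma finite_cells: "finite I \<Longrightarrow> finite (cells X a I)"
proof (induction I rule: finite_induct)
  case empty
  have "cells X a {} \<subseteq> {X}" by (auto simp: cells_def cell_def)
  then show ?case by (rule finite_subset) simp
next
  case (insert i I)
  then show ?case unfolding cells_insert by simp
qed

text \<open>Cutting a cell by a hyperplane does not change the total weight, so the sum is the one for
  the trivial arrangement, whose only cell is \<open>X\<close> itself.\<close>

lemma sum_halfspace_weight_cells:
  fixes a :: "'i \<Rightarrow> 'a::euclidean_space"
  assumes X: "subspace X" and "finite I"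
  shows "(\<Sum>F\<in>cells X a I. halfspace_weight v F) = (if X \<subseteq> {x. x \<bullet> v = 0} then (- 1) ^ dim X else 0)"
  using \<open>finite I\<close>
proof (induction I rule: finite_induct)
  case empty
  have "X \<noteq> {}" using X subspace_0 by blast
  moreover from this have "cells X a {} = {X}" by (auto simp: cells_def cell_def)
  \<comment> \<open>X is closed under negation, so a subspace in the half-space lies in its boundary
    hyperplane.\<close>
  moreover have "X \<subseteq> {x. x \<bullet> v \<le> 0} \<longleftrightarrow> X \<subseteq> {x. x \<bullet> v = 0}"
  proof
    assume sub: "X \<subseteq> {x. x \<bullet> v \<le> 0}"
    have "x \<bullet> v = 0" if "x \<in> X" for x
    proof -
      have "x \<bullet> v \<le> 0" "(- x) \<bullet> v \<le> 0" using sub that subspace_neg[OF X that] by blast+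
      then show ?thesis by simp
    qed
    then show "X \<subseteq> {x. x \<bullet> v = 0}" by blast
  qed auto
  ultimately show ?case by (simp add: halfspace_weight_def)
next
  case (insert i I)
  let ?P = "cells X a I \<times> {0, 1, - 1 :: real}" and ?f = "\<lambda>(F, s). F \<inter> sgn_part (a i) s"
  have "finite ?P" using insert(1) by (intro finite_cartesian_product finite_cells) simp_all
  have "(\<Sum>F\<in>cells X a (insert i I). halfspace_weight v F) = (\<Sum>F\<in>?f ` ?P. halfspace_weight v F)"
    unfolding cells_insert using \<open>finite ?P\<close>
    by (intro sum.mono_neutral_left) (auto simp: halfspace_weight_def)
  also have "\<dots> = (\<Sum>p\<in>?P. halfspace_weight v (?f p))"
  \<comment> \<open>Distinct pairs can give the same set only when that set is empty, since a common
    point determines both the cell and the sign; the empty set has weight 0.\<close>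
  proof (subst sum.reindex_nontrivial)
    show "finite ?P" by fact
    fix p q assume pq: "p \<in> ?P" "q \<in> ?P" "p \<noteq> q" "?f p = ?f q"
    have "?f p = {}"
    proof (rule ccontr)
      assume "?f p \<noteq> {}"
      then obtain x where "x \<in> ?f p" "x \<in> ?f q" using pq(4) by blast
      then have "fst p = cell X a I x" "fst q = cell X a I x" "snd p = snd q"
        using pq(1,2) by (auto dest: cells_mem_eq simp: sgn_part_def split: prod.splits)
      then show False using pq(3) by (simp add: prod_eq_iff)
    qed
    then show "halfspace_weight v (?f p) = 0" by (simp add: halfspace_weight_def)
  qed simp
  also have "\<dots> = (\<Sum>F\<in>cells X a I. \<Sum>s\<in>{0, 1, - 1}. halfspace_weight v (F \<inter> sgn_part (a i) s))"
    by (subst sum.cartesian_product) (simp add: case_prod_beta)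
  also have "\<dots> = (\<Sum>F\<in>cells X a I. halfspace_weight v F)"
  proof (rule sum.cong[OF refl])
    fix F assume "F \<in> cells X a I"
    then have "rel_open_cell F" using rel_open_cell_cell[OF X insert(1)] by (auto simp: cells_def)
    then show "(\<Sum>s\<in>{0, 1, - 1}. halfspace_weight v (F \<inter> sgn_part (a i) s)) = halfspace_weight v F"
      by (rule halfspace_weight_split)
  qed
  finally show ?case using insert.IH by simp
qed

subsection \<open>Chambers and their walls\<close>

lemma hyperplane_subset_eq:
  fixes a b :: "'a::euclidean_space"
  assumes "a \<noteq> 0" "b \<noteq> 0" "{x. a \<bullet> x = 0} \<subseteq> {x. b \<bullet> x = 0}"
  shows "{x. a \<bullet> x = 0} = {x. b \<bullet> x = 0}"
  using assms by (intro subspace_dim_equal) (auto simp: subspace_hyperplane dim_hyperplane)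

lemma span_eq_subspace_from_steps:
  assumes "subspace L" "T \<subseteq> L" "p \<in> T"
    and "\<And>y. y \<in> L \<Longrightarrow> \<exists>\<epsilon>>0. p + \<epsilon> *\<^sub>R y \<in> T"
  shows "span T = L"
proof
  show "span T \<subseteq> L" using assms(1,2) by (rule span_minimal[rotated])
  show "L \<subseteq> span T"
  proof
    fix y assume "y \<in> L"
    then obtain e where "e > 0" "p + e *\<^sub>R y \<in> T" using assms(4) by blast
    then show "y \<in> span T" using span_subset_from_steps[of p T e y] assms(3) by (simp add: span_base)
  qed
qed

text \<open>Orienting every normal towards v gives the base region the all-positive sign vector, so
  separation from the base becomes a negative sign.\<close>

locale based_arrangement =
  fixes A :: "'a::euclidean_space set set" and a :: "'a set \<Rightarrow> 'a" and v :: 'a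
  assumes finite_A: "finite A"
    and hyperplane_eq: "H \<in> A \<Longrightarrow> H = {x. a H \<bullet> x = 0}"
    and base_pos: "H \<in> A \<Longrightarrow> 0 < a H \<bullet> v"
begin

definition generic :: "'a \<Rightarrow> bool" where
  "generic x \<longleftrightarrow> (\<forall>H\<in>A. a H \<bullet> x \<noteq> 0)"

text \<open>The normal of H turned towards x. It depends on x only through its signs, hence is the
  same for all points of a chamber.\<close>

definition nrm :: "'a \<Rightarrow> 'a set \<Rightarrow> 'a" where
  "nrm x H = sgn (a H \<bullet> x) *\<^sub>R a H"

definition chamber :: "'a \<Rightarrow> 'a set" where
  "chamber x = {y. \<forall>H\<in>A. 0 < nrm x H \<bullet> y}"

definition closed_chamber :: "'a \<Rightarrow> 'a set" where
  "closed_chamber x = {y. \<forall>H\<in>A. 0 \<le> nrm x H \<bullet> y}"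

text \<open>Irredundancy instead of facets: some y violates the inequality of H and no other. Such a
  y already lies in the neighbouring chamber across H.\<close>

definition walls :: "'a \<Rightarrow> 'a set set" where
  "walls x = {H \<in> A. \<exists>y. nrm x H \<bullet> y < 0 \<and> (\<forall>K\<in>A - {H}. 0 < nrm x K \<bullet> y)}"

text \<open>The inversion set of the chamber of x relative to the base chamber of v.\<close>

definition neg :: "'a \<Rightarrow> 'a set set" where
  "neg x = {H \<in> A. a H \<bullet> x < 0}"

lemma mem_hyperplane: "H \<in> A \<Longrightarrow> y \<in> H \<longleftrightarrow> a H \<bullet> y = 0"
  using hyperplane_eq by blast

lemma a_nonzero: "H \<in> A \<Longrightarrow> a H \<noteq> 0"
  using base_pos by fastforce

lemma walls_subset: "walls x \<subseteq> A"
  by (auto simp: walls_def)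

lemma finite_walls: "finite (walls x)"
  using walls_subset finite_A by (rule finite_subset)

lemma generic_iff: "generic x \<longleftrightarrow> x \<notin> \<Union>A"
  using mem_hyperplane by (auto simp: generic_def)

lemma generic_base: "generic v"
  using base_pos by (force simp: generic_def)

lemma nrm_self: "generic x \<Longrightarrow> H \<in> A \<Longrightarrow> 0 < nrm x H \<bullet> x"
  by (auto simp: nrm_def generic_def sgn_if)

lemma nrm_zero_iff: "generic x \<Longrightarrow> H \<in> A \<Longrightarrow> nrm x H \<bullet> y = 0 \<longleftrightarrow> a H \<bullet> y = 0"
  by (auto simp: nrm_def generic_def sgn_if)

lemma nrm_pos_iff: "generic x \<Longrightarrow> H \<in> A \<Longrightarrow> 0 < nrm x H \<bullet> y \<longleftrightarrow> sgn (a H \<bullet> y) = sgn (a H \<bullet> x)"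
  by (auto simp: nrm_def generic_def sgn_if)

lemma closed_chamber_convex: "convex (closed_chamber x)"
proof -
  have "closed_chamber x = (\<Inter>H\<in>A. {y. 0 \<le> nrm x H \<bullet> y})" by (auto simp: closed_chamber_def)
  then show ?thesis by (simp add: convex_INT convex_halfspace_ge)
qed

lemma chamber_convex: "convex (chamber x)"
proof -
  have "chamber x = (\<Inter>H\<in>A. {y. nrm x H \<bullet> y > 0})" by (auto simp: chamber_def)
  then show ?thesis by (simp add: convex_INT convex_halfspace_gt)
qed

lemma closed_chamber_closed: "closed (closed_chamber x)"
proof -
  have "closed_chamber x = (\<Inter>H\<in>A. {y. nrm x H \<bullet> y \<ge> 0})" by (auto simp: closed_chamber_def)
  then show ?thesis by (simp add: closed_INT closed_halfspace_ge)
qed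

lemma chamber_self: "generic x \<Longrightarrow> x \<in> chamber x"
  by (simp add: chamber_def nrm_self)

lemma chamber_subset: "chamber x \<subseteq> closed_chamber x"
  by (auto simp: chamber_def closed_chamber_def less_imp_le)

lemma closed_chamber_cong:
  "(\<And>H. H \<in> A \<Longrightarrow> sgn (a H \<bullet> x) = sgn (a H \<bullet> y)) \<Longrightarrow> closed_chamber x = closed_chamber y"
  by (simp add: closed_chamber_def nrm_def)

lemma generic_in_closed_chamber:
  assumes "generic x" "generic y" "y \<in> closed_chamber x" "H \<in> A"
  shows "sgn (a H \<bullet> y) = sgn (a H \<bullet> x)"
proof -
  have "0 \<le> nrm x H \<bullet> y" "nrm x H \<bullet> y \<noteq> 0"
    using assms nrm_zero_iff by (auto simp: closed_chamber_def generic_def)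
  then show ?thesis using assms nrm_pos_iff by fastforce
qed

lemma closed_chamber_eq_iff:
  assumes "generic x" "generic y"
  shows "closed_chamber x = closed_chamber y \<longleftrightarrow> neg x = neg y"
proof
  assume "closed_chamber x = closed_chamber y"
  then have "sgn (a H \<bullet> y) = sgn (a H \<bullet> x)" if "H \<in> A" for H
    using that assms chamber_self chamber_subset generic_in_closed_chamber by blast
  then have "a H \<bullet> x < 0 \<longleftrightarrow> a H \<bullet> y < 0" if "H \<in> A" for H using that by (metis sgn_less)
  then show "neg x = neg y" by (auto simp: neg_def)
next
  assume eq: "neg x = neg y"
  have "sgn (a H \<bullet> x) = sgn (a H \<bullet> y)" if "H \<in> A" for H
  proof -
    have "a H \<bullet> x < 0 \<longleftrightarrow> a H \<bullet> y < 0" using eq that by (auto simp: neg_def)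
    moreover have "a H \<bullet> x \<noteq> 0" "a H \<bullet> y \<noteq> 0" using assms that by (auto simp: generic_def)
    ultimately show ?thesis by (simp add: sgn_if) linarith
  qed
  then show "closed_chamber x = closed_chamber y" by (rule closed_chamber_cong)
qed

text \<open>In a minimal set \<open>W\<close> of inequalities defining the chamber, every \<open>H \<in> W\<close> is a wall: the
  segment from \<open>x\<close> to a point violating only \<open>H\<close> meets \<open>H\<close> in a point lying strictly inside all
  the other half-spaces.\<close>

lemma walls_determine:
  assumes x: "generic x" and y: "\<And>H. H \<in> walls x \<Longrightarrow> 0 < nrm x H \<bullet> y"
  shows "y \<in> chamber x"
proof -
  define P where "P W \<longleftrightarrow> W \<subseteq> A \<and> {y. \<forall>H\<in>W. 0 < nrm x H \<bullet> y} \<subseteq> chamber x" for W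
  have "P A" by (auto simp: P_def chamber_def)
  then obtain W where W: "P W" and W_min: "\<And>W'. P W' \<Longrightarrow> card W \<le> card W'"
    using ex_has_least_nat[of P A card] by blast
  have "W \<subseteq> A" and W_chamber: "\<And>y. (\<And>H. H \<in> W \<Longrightarrow> 0 < nrm x H \<bullet> y) \<Longrightarrow> y \<in> chamber x"
    using W by (auto simp: P_def)
  then have "finite W" using finite_A finite_subset by blast
  have "H \<in> walls x" if "H \<in> W" for H
  proof -
    have "H \<in> A" using that \<open>W \<subseteq> A\<close> by blast
    have "\<not> P (W - {H})"
      using W_min[of "W - {H}"] card_Diff1_less[OF \<open>finite W\<close> that] by auto
    then obtain y where y: "\<And>K. K \<in> W - {H} \<Longrightarrow> 0 < nrm x K \<bullet> y" "y \<notin> chamber x"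
      using \<open>W \<subseteq> A\<close> by (auto simp: P_def)
    have yH: "nrm x H \<bullet> y \<le> 0"
    proof (rule ccontr)
      assume "\<not> ?thesis"
      then have "0 < nrm x K \<bullet> y" if "K \<in> W" for K using y(1)[of K] that by (cases "K = H") auto
      then show False using y(2) W_chamber by blast
    qed
    have xH: "0 < nrm x H \<bullet> x" using nrm_self[OF x \<open>H \<in> A\<close>] .
    define t where "t = (nrm x H \<bullet> x) / (nrm x H \<bullet> x - nrm x H \<bullet> y)"
    define z where "z = (1 - t) *\<^sub>R x + t *\<^sub>R y"
    have t: "0 < t" "t \<le> 1" using xH yH by (auto simp: t_def field_simps)
    have "nrm x H \<bullet> z = nrm x H \<bullet> x - t * (nrm x H \<bullet> x - nrm x H \<bullet> y)"
      by (simp add: z_def inner_add_right algebra_simps)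
    then have zH: "nrm x H \<bullet> z = 0" using xH yH by (simp add: t_def)
    have zW: "0 < nrm x K \<bullet> z" if "K \<in> W - {H}" for K
    proof -
      have "K \<in> A" using that \<open>W \<subseteq> A\<close> by blast
      then have "0 \<le> (1 - t) * (nrm x K \<bullet> x)" using t nrm_self[OF x, of K] by simp
      moreover have "0 < t * (nrm x K \<bullet> y)" using t y(1)[OF that] by simp
      ultimately show ?thesis by (simp add: z_def inner_add_right)
    qed
    \<comment> \<open>Pushing z towards x makes the inequalities of W strict, hence all of those of
      A; the limit gives >= 0. Strictness is a separate argument.\<close>
    have z_other: "0 < nrm x K \<bullet> z" if K: "K \<in> A - {H}" for K
    proof -
      have "0 \<le> nrm x K \<bullet> z + s * (nrm x K \<bullet> x)" if "0 < s" for s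
      proof -
        have "0 < nrm x J \<bullet> (z + s *\<^sub>R x)" if "J \<in> W" for J
        proof -
          have "0 < s * (nrm x J \<bullet> x)" using nrm_self[OF x, of J] that \<open>W \<subseteq> A\<close> \<open>0 < s\<close> by auto
          then show ?thesis using zW[of J] zH that by (cases "J = H") (auto simp: inner_add_right)
        qed
        then have "z + s *\<^sub>R x \<in> chamber x" by (rule W_chamber)
        then show ?thesis using K by (auto simp: chamber_def inner_add_right less_imp_le)
      qed
      then have "0 \<le> nrm x K \<bullet> z" by (rule affine_nonneg_at_zero)
      \<comment> \<open>If z were also on K, a move along a direction of K that enters the positive
        side of H would satisfy all inequalities of W strictly while staying on K. This contradicts
        the choice of W.\<close>
      moreover have "nrm x K \<bullet> z \<noteq> 0"
      proof
        assume zK: "nrm x K \<bullet> z = 0"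
        have "\<not> K \<subseteq> H"
          using hyperplane_subset_eq[of "a K" "a H"] a_nonzero hyperplane_eq K \<open>H \<in> A\<close> by (metis DiffD1 DiffD2 singletonI)
        then obtain u where u: "a K \<bullet> u = 0" "a H \<bullet> u \<noteq> 0"
          using mem_hyperplane K \<open>H \<in> A\<close> by auto
        define u' where "u' = sgn (nrm x H \<bullet> u) *\<^sub>R u"
        have u': "nrm x K \<bullet> u' = 0" "0 < nrm x H \<bullet> u'"
          using u nrm_zero_iff[OF x \<open>H \<in> A\<close>, of u] by (auto simp: u'_def nrm_def sgn_if)
        obtain d where d: "d > 0" "\<And>t J. \<bar>t\<bar> \<le> d \<Longrightarrow> J \<in> W - {H} \<Longrightarrow> nrm x J \<bullet> z \<noteq> 0 \<Longrightarrow>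
            sgn (nrm x J \<bullet> (z + t *\<^sub>R u')) = sgn (nrm x J \<bullet> z)"
          using sgn_perturb[of "W - {H}" "nrm x" z u'] \<open>finite W\<close> by auto
        have "0 < nrm x J \<bullet> (z + d *\<^sub>R u')" if "J \<in> W" for J
        proof (cases "J = H")
          case True
          then show ?thesis using zH u' d(1) by (simp add: inner_add_right)
        next
          case False
          then have "sgn (nrm x J \<bullet> (z + d *\<^sub>R u')) = 1"
            using d(1) d(2)[of d J] zW[of J] that by simp
          then show ?thesis by (simp add: sgn_1_pos)
        qed
        then have "z + d *\<^sub>R u' \<in> chamber x" by (rule W_chamber)
        then have "0 < nrm x K \<bullet> (z + d *\<^sub>R u')" using K by (simp add: chamber_def)
        then show False using zK u' by (simp add: inner_add_right)
      qed
      ultimately show ?thesis by simp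
    qed
    \<comment> \<open>Since z is on H and strictly inside all other half-spaces, a small step
      against the normal of H violates H alone.\<close>
    obtain d where d: "d > 0" "\<And>t J. \<bar>t\<bar> \<le> d \<Longrightarrow> J \<in> A - {H} \<Longrightarrow> nrm x J \<bullet> z \<noteq> 0 \<Longrightarrow>
        sgn (nrm x J \<bullet> (z + t *\<^sub>R nrm x H)) = sgn (nrm x J \<bullet> z)"
      using sgn_perturb[of "A - {H}" "nrm x" z "nrm x H"] finite_A by auto
    have "0 < nrm x J \<bullet> (z + (- d) *\<^sub>R nrm x H)" if "J \<in> A - {H}" for J
      using d(1) d(2)[of "- d" J] z_other[OF that] that by (simp add: sgn_1_pos)
    moreover have "nrm x H \<noteq> 0" using xH by auto
    then have "nrm x H \<bullet> (z + (- d) *\<^sub>R nrm x H) < 0"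
      using zH d(1) by (simp add: inner_diff_right)
    ultimately show ?thesis using \<open>H \<in> A\<close> unfolding walls_def by blast
  qed
  then show ?thesis using y W_chamber by blast
qed

lemma closed_chamber_limit:
  assumes "generic x" and "\<And>t. 0 < t \<Longrightarrow> y + t *\<^sub>R z \<in> closed_chamber x"
  shows "y \<in> closed_chamber x"
proof -
  have "0 \<le> nrm x H \<bullet> y" if "H \<in> A" for H
  proof (rule affine_nonneg_at_zero)
    fix t :: real assume "0 < t"
    then show "0 \<le> nrm x H \<bullet> y + t * (nrm x H \<bullet> z)"
      using assms(2)[of t] that by (simp add: closed_chamber_def inner_add_right)
  qed
  then show ?thesis by (simp add: closed_chamber_def)
qed

text \<open>Adding a small multiple of x makes the wall inequalities strict, so the open version
  applies before passing to the limit.\<close>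

lemma walls_determine_closed:
  assumes x: "generic x" and y: "\<And>H. H \<in> walls x \<Longrightarrow> 0 \<le> nrm x H \<bullet> y"
  shows "y \<in> closed_chamber x"
proof (rule closed_chamber_limit[OF x])
  fix t :: real assume "0 < t"
  have "y + t *\<^sub>R x \<in> chamber x"
  proof (rule walls_determine[OF x])
    fix H assume H: "H \<in> walls x"
    then have "0 < nrm x H \<bullet> x" using nrm_self[OF x] walls_subset by blast
    then have "0 < t * (nrm x H \<bullet> x)" using \<open>0 < t\<close> by simp
    then show "0 < nrm x H \<bullet> (y + t *\<^sub>R x)" using y[OF H] by (simp add: inner_add_right add_nonneg_pos)
  qed
  then show "y + t *\<^sub>R x \<in> closed_chamber x" using chamber_subset by blast
qed

lemma wall_point:
  assumes x: "generic x" and H: "H \<in> walls x"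
  obtains z where "nrm x H \<bullet> z = 0" "\<And>K. K \<in> A - {H} \<Longrightarrow> 0 < nrm x K \<bullet> z"
proof -
  obtain y where y: "nrm x H \<bullet> y < 0" "\<And>K. K \<in> A - {H} \<Longrightarrow> 0 < nrm x K \<bullet> y" and "H \<in> A"
    using H by (auto simp: walls_def)
  obtain t where t: "0 < t" "t < 1" "(1 - t) *\<^sub>R x + t *\<^sub>R y \<in> UNIV \<inter> sgn_part (nrm x H) 0"
    using crossing_point[of UNIV x y "nrm x H"] nrm_self[OF x \<open>H \<in> A\<close>] y(1) by auto
  show ?thesis
  proof
    show "nrm x H \<bullet> ((1 - t) *\<^sub>R x + t *\<^sub>R y) = 0" using t(3) by (simp add: mem_sgn_part)
    fix K assume K: "K \<in> A - {H}"
    then show "0 < nrm x K \<bullet> ((1 - t) *\<^sub>R x + t *\<^sub>R y)"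
      using t(1,2) y(2)[OF K] nrm_self[OF x, of K] by (simp add: inner_add_right add_pos_pos)
  qed
qed

subsection \<open>Regions\<close>

text \<open>A connected set that avoids all hyperplanes cannot change a sign, and a chamber is
  convex. The subspace V serves both the arrangement itself (V = \<open>UNIV\<close>) and its
  essentialization.\<close>

lemma component_eq_chamber:
  assumes "subspace V" "x \<in> V" "generic x"
  shows "connected_component_set (V - \<Union>A) x = V \<inter> chamber x"
proof
  show "connected_component_set (V - \<Union>A) x \<subseteq> V \<inter> chamber x"
  proof
    fix y assume "y \<in> connected_component_set (V - \<Union>A) x"
    then obtain T where T: "connected T" "T \<subseteq> V - \<Union>A" "x \<in> T" "y \<in> T"
      by (auto simp: connected_component_def)
    have "0 < nrm x H \<bullet> y" if "H \<in> A" for H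
    proof (rule ccontr)
      assume "\<not> 0 < nrm x H \<bullet> y"
      moreover have "0 < nrm x H \<bullet> x" using nrm_self assms(3) that .
      ultimately obtain z where "z \<in> T" "nrm x H \<bullet> z = 0"
        using connected_ivt_hyperplane[OF T(1,4,3), of "nrm x H" 0] by auto
      then show False using nrm_zero_iff[OF assms(3) that] T(2) mem_hyperplane[OF that] that by blast
    qed
    then show "y \<in> V \<inter> chamber x" using T by (auto simp: chamber_def)
  qed
  have "V \<inter> chamber x \<subseteq> V - \<Union>A"
  proof -
    have "a H \<bullet> y \<noteq> 0" if "y \<in> chamber x" "H \<in> A" for y H
      using that nrm_zero_iff[OF assms(3) that(2), of y] by (force simp: chamber_def)
    then show ?thesis using mem_hyperplane by blast
  qed
  moreover have "connected (V \<inter> chamber x)"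
    using assms(1) by (simp add: convex_connected convex_Int subspace_imp_convex chamber_convex)
  ultimately show "V \<inter> chamber x \<subseteq> connected_component_set (V - \<Union>A) x"
    using assms(2,3) chamber_self by (intro connected_component_maximal) auto
qed

lemma closure_chamber:
  assumes "subspace V" "x \<in> V" "generic x"
  shows "closure (V \<inter> chamber x) = V \<inter> closed_chamber x"
proof
  have "closed (V \<inter> closed_chamber x)"
    using assms(1) by (simp add: closed_Int closed_subspace closed_chamber_closed)
  then show "closure (V \<inter> chamber x) \<subseteq> V \<inter> closed_chamber x"
    using chamber_subset by (intro closure_minimal) auto
  show "V \<inter> closed_chamber x \<subseteq> closure (V \<inter> chamber x)"
  proof
    fix y assume y: "y \<in> V \<inter> closed_chamber x"
    have "y + (1 / Suc n) *\<^sub>R x \<in> V \<inter> chamber x" for n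
    proof -
      have "0 < nrm x H \<bullet> (y + (1 / Suc n) *\<^sub>R x)" if "H \<in> A" for H
      proof -
        have "0 \<le> nrm x H \<bullet> y" using y that by (simp add: closed_chamber_def)
        moreover have "0 < (1 / Suc n) * (nrm x H \<bullet> x)" using nrm_self[OF assms(3) that] by simp
        ultimately show ?thesis by (simp only: inner_add_right inner_scaleR_right add_nonneg_pos)
      qed
      moreover have "y + (1 / Suc n) *\<^sub>R x \<in> V" using y assms by (simp add: subspace_add subspace_scale)
      ultimately show ?thesis by (simp add: chamber_def)
    qed
    moreover have "(\<lambda>n. y + (1 / Suc n) *\<^sub>R x) \<longlonglongrightarrow> y + 0 *\<^sub>R x"
      by (intro tendsto_intros LIMSEQ_Suc[OF lim_1_over_n])
    ultimately show "y \<in> closure (V \<inter> chamber x)"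
      unfolding closure_sequential by (intro exI[of _ "\<lambda>n. y + (1 / Suc n) *\<^sub>R x"]) auto
  qed
qed

lemma regions_within_eq:
  assumes "subspace V"
  shows "regions_within V A = {V \<inter> closed_chamber x | x. x \<in> V \<and> generic x}"
  unfolding regions_within_def using component_eq_chamber closure_chamber assms generic_iff by (metis (no_types, opaque_lifting) Diff_iff)

lemma regions_eq: "regions A = closed_chamber ` {x. generic x}"
  unfolding regions_def regions_within_eq[OF subspace_UNIV] by auto

lemma region_of_base: "region_of A v = closed_chamber v"
  unfolding region_of_def
proof (rule the_equality)
  show "closed_chamber v \<in> regions A \<and> v \<in> closed_chamber v"
    using generic_base chamber_self chamber_subset by (auto simp: regions_eq)
  fix C assume "C \<in> regions A \<and> v \<in> C"
  then obtain x where "generic x" "C = closed_chamber x" "v \<in> closed_chamber x" by (auto simp: regions_eq)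
  then show "C = closed_chamber v"
    using generic_in_closed_chamber[OF _ generic_base] closed_chamber_cong by metis
qed

subsection \<open>Descents in the weak order\<close>

text \<open>The definition of \<open>separates\<close> admits any normal b of H, so its sign has to
  be matched with that of \<open>a H\<close>.\<close>

lemma separates_iff:
  assumes x: "generic x" and H: "H \<in> A"
  shows "separates H (closed_chamber v) (closed_chamber x) \<longleftrightarrow> H \<in> neg x"
proof
  assume "H \<in> neg x"
  then have neg: "a H \<bullet> x < 0" by (simp add: neg_def)
  have "nrm v H = a H" "nrm x H = - a H" using base_pos[OF H] neg by (auto simp: nrm_def)
  then have "\<forall>y\<in>closed_chamber v. 0 \<le> a H \<bullet> y" "\<forall>y\<in>closed_chamber x. a H \<bullet> y \<le> 0"
    using H by (force simp: closed_chamber_def)+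
  then show "separates H (closed_chamber v) (closed_chamber x)"
    using hyperplane_eq[OF H] unfolding separates_def by blast
next
  assume "separates H (closed_chamber v) (closed_chamber x)"
  then obtain b where b: "H = {x. b \<bullet> x = 0}" "0 \<le> b \<bullet> v" "b \<bullet> x \<le> 0"
    using chamber_self[OF x] chamber_self[OF generic_base] chamber_subset unfolding separates_def by blast
  have "v \<notin> H" "x \<notin> H" using mem_hyperplane[OF H] generic_base x H by (auto simp: generic_def)
  then have b': "0 < b \<bullet> v" "b \<bullet> x < 0" using b by auto
  \<comment> \<open>The segment from v to x crosses H by the signs of b, whereas \<open>a H\<close>
    would be positive along all of it.\<close>
  have "\<not> 0 < a H \<bullet> x"
  proof
    assume pos: "0 < a H \<bullet> x"
    obtain t where t: "0 < t" "t < 1" "(1 - t) *\<^sub>R v + t *\<^sub>R x \<in> UNIV \<inter> sgn_part b 0"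
      using crossing_point[of UNIV v x b] b' by auto
    then have "(1 - t) *\<^sub>R v + t *\<^sub>R x \<in> H" using b(1) by (simp add: mem_sgn_part)
    then have "a H \<bullet> ((1 - t) *\<^sub>R v + t *\<^sub>R x) = 0" using mem_hyperplane[OF H] by blast
    moreover have "0 < a H \<bullet> ((1 - t) *\<^sub>R v + t *\<^sub>R x)"
      using t(1,2) pos base_pos[OF H] by (simp add: inner_add_right add_pos_pos)
    ultimately show False by simp
  qed
  then show "H \<in> neg x" using x H by (auto simp: neg_def generic_def not_less order_le_less)
qed

lemma neg_subset: "neg x \<subseteq> A"
  by (auto simp: neg_def)

lemma weak_le_iff:
  assumes "generic x" "generic y"
  shows "weak_le A (closed_chamber v) (closed_chamber x) (closed_chamber y) \<longleftrightarrow> neg x \<subseteq> neg y"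
  unfolding weak_le_def using separates_iff[OF assms(1)] separates_iff[OF assms(2)] neg_subset by blast

lemma flip_wall:
  assumes x: "generic x" and H: "H \<in> walls x" "H \<in> neg x"
  obtains y where "generic y" "neg y = neg x - {H}"
proof -
  obtain y where y: "nrm x H \<bullet> y < 0" "\<And>K. K \<in> A - {H} \<Longrightarrow> 0 < nrm x K \<bullet> y" and "H \<in> A"
    using H by (auto simp: walls_def)
  have yH: "a H \<bullet> y > 0" using H(2) y(1) by (auto simp: nrm_def neg_def)
  have yK: "sgn (a K \<bullet> y) = sgn (a K \<bullet> x)" if "K \<in> A" "K \<noteq> H" for K
    using that y(2)[of K] nrm_pos_iff[OF x] by simp
  show ?thesis
  proof
    show "generic y" unfolding generic_def
    proof
      fix K assume "K \<in> A"
      then show "a K \<bullet> y \<noteq> 0" using yH yK[of K] x by (cases "K = H") (auto simp: generic_def sgn_0_0 dest: sym)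
    qed
    show "neg y = neg x - {H}"
    proof -
      have "a K \<bullet> y < 0 \<longleftrightarrow> a K \<bullet> x < 0 \<and> K \<noteq> H" if "K \<in> A" for K
        using yH yK[OF that] sgn_less[of "a K \<bullet> y"] sgn_less[of "a K \<bullet> x"] by (cases "K = H") auto
      then show ?thesis by (auto simp: neg_def)
    qed
  qed
qed

text \<open>Some wall inequality of x must fail at y, since y is in another chamber. The signs
  differ at that wall, and the inclusion of inversion sets fixes which of the two is
  negative.\<close>

lemma wall_between:
  assumes x: "generic x" and y: "generic y" and "neg y \<subset> neg x"
  obtains H where "H \<in> walls x" "H \<in> neg x - neg y"
proof -
  have "y \<notin> chamber x"
  proof
    assume "y \<in> chamber x"
    then have "closed_chamber y = closed_chamber x"
      using x y generic_in_closed_chamber chamber_subset closed_chamber_cong by (metis subsetD)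
    then show False using closed_chamber_eq_iff[OF y x] assms(3) by blast
  qed
  then obtain H where H: "H \<in> walls x" "\<not> 0 < nrm x H \<bullet> y" using walls_determine[OF x] by blast
  have "H \<in> A" using H(1) walls_subset by blast
  then have "sgn (a H \<bullet> y) \<noteq> sgn (a H \<bullet> x)" using H(2) nrm_pos_iff[OF x] by blast
  moreover have "a H \<bullet> y \<noteq> 0" "a H \<bullet> x \<noteq> 0" using x y \<open>H \<in> A\<close> by (auto simp: generic_def)
  ultimately have "H \<in> neg x - neg y"
    using \<open>H \<in> A\<close> assms(3) by (auto simp: neg_def sgn_if split: if_splits)
  then show ?thesis using that H(1) by blast
qed

text \<open>Below x one can always cross a wall that is still above or equal to y, so a cover
  crosses exactly that wall. Conversely, no set fits strictly between two sets that differ by one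
  element.\<close>

lemma covers_iff:
  assumes x: "generic x" and y: "generic y"
  shows "covers A (closed_chamber v) (closed_chamber x) (closed_chamber y) \<longleftrightarrow>
    (\<exists>H \<in> walls x \<inter> neg x. neg y = neg x - {H})"
proof -
  have "covers A (closed_chamber v) (closed_chamber x) (closed_chamber y) \<longleftrightarrow>
      neg y \<subseteq> neg x \<and> neg y \<noteq> neg x \<and>
      \<not> (\<exists>e. generic e \<and> neg y \<subseteq> neg e \<and> neg e \<subseteq> neg x \<and> neg e \<noteq> neg y \<and> neg e \<noteq> neg x)"
    using x y by (auto simp: covers_def regions_eq weak_le_iff closed_chamber_eq_iff)
  also have "\<dots> \<longleftrightarrow> (\<exists>H \<in> walls x \<inter> neg x. neg y = neg x - {H})"
  proof
    assume L: "neg y \<subseteq> neg x \<and> neg y \<noteq> neg x \<and>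
      \<not> (\<exists>e. generic e \<and> neg y \<subseteq> neg e \<and> neg e \<subseteq> neg x \<and> neg e \<noteq> neg y \<and> neg e \<noteq> neg x)"
    then obtain H where H: "H \<in> walls x" "H \<in> neg x - neg y"
      using wall_between[OF x y] by blast
    then obtain e where e: "generic e" "neg e = neg x - {H}" using flip_wall[OF x] by blast
    have "neg y \<subseteq> neg e" "neg e \<subseteq> neg x" "neg e \<noteq> neg x" using e(2) H L by auto
    then have "neg e = neg y" using L e(1) by blast
    then show "\<exists>H \<in> walls x \<inter> neg x. neg y = neg x - {H}" using H e(2) by blast
  qed auto
  finally show ?thesis .
qed

lemma des_eq:
  assumes x: "generic x"
  shows "des A (closed_chamber v) (closed_chamber x) = card (walls x \<inter> neg x)"
proof -
  let ?W = "walls x \<inter> neg x"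
  have "\<exists>y. generic y \<and> neg y = neg x - {H}" if "H \<in> ?W" for H
    using flip_wall[OF x] that by blast
  then obtain f where f: "\<And>H. H \<in> ?W \<Longrightarrow> generic (f H)" "\<And>H. H \<in> ?W \<Longrightarrow> neg (f H) = neg x - {H}"
    by metis
  have "bij_betw (\<lambda>H. closed_chamber (f H)) ?W {D \<in> regions A. covers A (closed_chamber v) (closed_chamber x) D}"
    unfolding bij_betw_def
  proof
    show "inj_on (\<lambda>H. closed_chamber (f H)) ?W"
    proof (rule inj_onI)
      fix H K assume HK: "H \<in> ?W" "K \<in> ?W" "closed_chamber (f H) = closed_chamber (f K)"
      then have "neg (f H) = neg (f K)" using closed_chamber_eq_iff f(1) by blast
      then have "neg x - {H} = neg x - {K}" using HK f(2) by auto
      then show "H = K" using HK by blast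
    qed
    show "(\<lambda>H. closed_chamber (f H)) ` ?W = {D \<in> regions A. covers A (closed_chamber v) (closed_chamber x) D}"
    proof (intro equalityI subsetI)
      fix D assume "D \<in> (\<lambda>H. closed_chamber (f H)) ` ?W"
      then obtain H where H: "H \<in> ?W" "D = closed_chamber (f H)" by blast
      then have "covers A (closed_chamber v) (closed_chamber x) D"
        using covers_iff[OF x f(1)[OF H(1)]] f(2)[OF H(1)] by blast
      then show "D \<in> {D \<in> regions A. covers A (closed_chamber v) (closed_chamber x) D}"
        by (simp add: covers_def)
    next
      fix D assume "D \<in> {D \<in> regions A. covers A (closed_chamber v) (closed_chamber x) D}"
      then obtain y where y: "generic y" "D = closed_chamber y" "covers A (closed_chamber v) (closed_chamber x) (closed_chamber y)"
        by (auto simp: regions_eq)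
      then obtain H where H: "H \<in> ?W" "neg y = neg x - {H}" using covers_iff[OF x] by blast
      then have "D = closed_chamber (f H)" using closed_chamber_eq_iff[OF y(1) f(1)[OF H(1)]] f(2)[OF H(1)] H(2) y(2) by simp
      then show "D \<in> (\<lambda>H. closed_chamber (f H)) ` ?W" using H(1) by blast
    qed
  qed
  then show ?thesis unfolding des_def by (metis bij_betw_same_card)
qed

subsection \<open>Walls of a sharp arrangement\<close>

text \<open>Transfers walls to facets of an essential region. All normals lie in V, the orthogonal
  complement of the bottom flat, so x and the wall points can be projected to V without changing any
  sign; the section of the region by a wall is then a facet with the expected inward normal.\<close>

lemma sharp_walls_obtuse:
  assumes sharp: "sharp A" and x: "generic x" and HK: "H \<in> walls x" "K \<in> walls x" "H \<noteq> K"
  shows "nrm x H \<bullet> nrm x K \<le> 0"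
proof -
  define V where "V = orthogonal_comp (bottom_flat A)"
  have "subspace V" by (simp add: V_def subspace_orthogonal_comp)
  have sub_bot: "subspace (bottom_flat A)"
    unfolding bottom_flat_def by (intro subspace_Inter ballI) (metis hyperplane_eq subspace_hyperplane)
  have "a J \<in> V" if "J \<in> A" for J
    unfolding V_def orthogonal_comp_def orthogonal_def bottom_flat_def
    using mem_hyperplane[OF that] that by (auto simp: inner_commute)
  then have nrm_V: "nrm x J \<in> V" if "J \<in> A" for J
    using that \<open>subspace V\<close> by (simp add: nrm_def subspace_scale)
  have proj: "\<exists>y'\<in>V. \<forall>J\<in>A. a J \<bullet> y' = a J \<bullet> y" for y
  proof -
    obtain p q where pq: "p \<in> span (bottom_flat A)" "\<And>w. w \<in> span (bottom_flat A) \<Longrightarrow> orthogonal q w" "y = p + q"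
      using orthogonal_subspace_decomp_exists by metis
    have "q \<in> V" unfolding V_def orthogonal_comp_def
      using pq(2) by (auto simp: span_base orthogonal_commute)
    moreover have "p \<in> bottom_flat A" using pq(1) sub_bot by (metis span_eq_iff)
    then have "\<forall>J\<in>A. a J \<bullet> p = 0" using mem_hyperplane by (auto simp: bottom_flat_def)
    ultimately show ?thesis using pq(3) by (auto simp: inner_add_right)
  qed
  then obtain x' where x': "x' \<in> V" "\<And>J. J \<in> A \<Longrightarrow> a J \<bullet> x' = a J \<bullet> x" by meson
  have gx': "generic x'" using x x'(2) by (simp add: generic_def)
  have nrm': "nrm x' J = nrm x J" if "J \<in> A" for J using x'(2) that by (simp add: nrm_def)
  define C where "C = V \<inter> closed_chamber x'"
  have C_mem: "y \<in> C \<longleftrightarrow> y \<in> V \<and> (\<forall>J\<in>A. 0 \<le> nrm x J \<bullet> y)" for y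
    by (auto simp: C_def closed_chamber_def nrm')
  have C_reg: "C \<in> ess_regions A"
    unfolding ess_regions_def V_def[symmetric] regions_within_eq[OF \<open>subspace V\<close>] C_def using x' gx' by blast
  have "convex C" using \<open>subspace V\<close> by (simp add: C_def convex_Int subspace_imp_convex closed_chamber_convex)
  have posx': "0 < nrm x J \<bullet> x'" if "J \<in> A" for J using nrm_self[OF gx' that] nrm' that by simp
  \<comment> \<open>Spans turn the affine dimensions in \<open>facets\<close> into linear ones, as C
    and its wall sections contain 0.\<close>
  have "span C = V"
  proof (rule span_eq_subspace_from_steps[OF \<open>subspace V\<close>])
    show "C \<subseteq> V" by (simp add: C_def)
    show "x' \<in> C" using x'(1) posx' by (auto simp: C_mem less_imp_le)
    fix y assume "y \<in> V"
    obtain d where d: "d > 0" "\<And>t J. \<bar>t\<bar> \<le> d \<Longrightarrow> J \<in> A \<Longrightarrow> nrm x J \<bullet> x' \<noteq> 0 \<Longrightarrow>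
        sgn (nrm x J \<bullet> (x' + t *\<^sub>R y)) = sgn (nrm x J \<bullet> x')"
      using sgn_perturb[OF finite_A, of "nrm x" x' y] by auto
    have "0 \<le> nrm x J \<bullet> (x' + d *\<^sub>R y)" if "J \<in> A" for J
      using d(1) d(2)[of d J] that posx'[OF that] by (simp add: sgn_1_pos less_imp_le)
    then have "x' + d *\<^sub>R y \<in> C"
      using \<open>y \<in> V\<close> x'(1) \<open>subspace V\<close> by (simp add: C_mem subspace_add subspace_scale)
    then show "\<exists>\<epsilon>>0. x' + \<epsilon> *\<^sub>R y \<in> C" using d(1) by blast
  qed
  have "0 \<in> C" using \<open>subspace V\<close> by (simp add: C_mem subspace_0)
  have aff_C: "aff_dim C = int (dim V)"
    using aff_dim_zero[OF hull_inc[OF \<open>0 \<in> C\<close>]] \<open>span C = V\<close> by (metis dim_span)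
  define F where "F J = C \<inter> {y. nrm x J \<bullet> y = 0}" for J
  have facet: "F J \<in> facets C \<and> inward_normal V C (F J) (nrm x J) \<and>
      (\<exists>z\<in>F J. \<forall>K\<in>A - {J}. 0 < nrm x K \<bullet> z)" if J: "J \<in> walls x" for J
  proof -
    have "J \<in> A" using J walls_subset by blast
    obtain z0 where z0: "nrm x J \<bullet> z0 = 0" "\<And>K. K \<in> A - {J} \<Longrightarrow> 0 < nrm x K \<bullet> z0"
      using wall_point[OF x J] by blast
    obtain z where "z \<in> V" "\<And>K. K \<in> A \<Longrightarrow> a K \<bullet> z = a K \<bullet> z0" using proj by meson
    then have z: "z \<in> V" "nrm x J \<bullet> z = 0" "\<And>K. K \<in> A - {J} \<Longrightarrow> 0 < nrm x K \<bullet> z"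
      using z0 \<open>J \<in> A\<close> by (auto simp: nrm_def)
    have zF: "z \<in> F J"
      unfolding F_def using z by (auto simp: C_mem) (metis DiffI less_imp_le order_refl singletonD)
    have span_F: "span (F J) = V \<inter> {y. nrm x J \<bullet> y = 0}"
    proof (rule span_eq_subspace_from_steps[OF _ _ zF])
      show "subspace (V \<inter> {y. nrm x J \<bullet> y = 0})"
        using \<open>subspace V\<close> by (simp add: subspace_inter subspace_hyperplane)
      show "F J \<subseteq> V \<inter> {y. nrm x J \<bullet> y = 0}" by (auto simp: F_def C_def)
      fix y assume y: "y \<in> V \<inter> {y. nrm x J \<bullet> y = 0}"
      obtain d where d: "d > 0" "\<And>t K. \<bar>t\<bar> \<le> d \<Longrightarrow> K \<in> A \<Longrightarrow> nrm x K \<bullet> z \<noteq> 0 \<Longrightarrow>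
          sgn (nrm x K \<bullet> (z + t *\<^sub>R y)) = sgn (nrm x K \<bullet> z)"
        using sgn_perturb[OF finite_A, of "nrm x" z y] by auto
      have zJ: "nrm x J \<bullet> (z + d *\<^sub>R y) = 0" using z y by (simp add: inner_add_right)
      have "0 \<le> nrm x K \<bullet> (z + d *\<^sub>R y)" if "K \<in> A" for K
      proof (cases "K = J")
        case False
        then show ?thesis using d(1) d(2)[of d K] that z(3)[of K] by (simp add: sgn_1_pos less_imp_le)
      qed (use zJ in simp)
      then have "z + d *\<^sub>R y \<in> F J"
        using y z(1) zJ \<open>subspace V\<close> by (simp add: F_def C_mem subspace_add subspace_scale)
      then show "\<exists>\<epsilon>>0. z + \<epsilon> *\<^sub>R y \<in> F J" using d(1) by blast
    qed
    have "dim (V \<inter> {y. nrm x J \<bullet> y = 0}) + 1 = dim V"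
      using dim_subspace_inter_hyperplane[OF \<open>subspace V\<close> x'(1)] posx'[OF \<open>J \<in> A\<close>] by simp
    then have "dim (F J) + 1 = dim V" using span_F by (metis dim_span)
    moreover have "0 \<in> F J" using \<open>0 \<in> C\<close> by (simp add: F_def)
    then have "aff_dim (F J) = int (dim (F J))" by (intro aff_dim_zero hull_inc)
    ultimately have "aff_dim (F J) = aff_dim C - 1" using aff_C by linarith
    moreover have "F J face_of C"
      unfolding F_def using \<open>J \<in> A\<close>
      by (intro face_of_Int_supporting_hyperplane_ge \<open>convex C\<close>) (simp add: C_mem)
    ultimately have "F J \<in> facets C" by (simp add: facets_def)
    moreover have "inward_normal V C (F J) (nrm x J)"
      using nrm_V[OF \<open>J \<in> A\<close>] posx'[OF \<open>J \<in> A\<close>] \<open>J \<in> A\<close> by (auto simp: inward_normal_def F_def C_mem)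
    ultimately show ?thesis using zF z(3) by blast
  qed
  \<comment> \<open>A wall point of H lies strictly inside the half-space of K.\<close>
  have "F H \<noteq> F K"
  proof
    assume "F H = F K"
    moreover obtain z where "z \<in> F H" "0 < nrm x K \<bullet> z" using facet[OF HK(1)] HK walls_subset by blast
    ultimately show False by (simp add: F_def)
  qed
  then show ?thesis
    using sharp[unfolded sharp_def V_def[symmetric], THEN conjunct2, rule_format, OF C_reg, of "F H" "F K"]
      facet[OF HK(1)] facet[OF HK(2)] by simp
qed

end

subsection \<open>Faces and descent sets\<close>

locale obtuse_arrangement = based_arrangement +
  assumes obtuse: "generic x \<Longrightarrow> H \<in> walls x \<Longrightarrow> K \<in> walls x \<Longrightarrow> H \<noteq> K \<Longrightarrow> nrm x H \<bullet> nrm x K \<le> 0"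
begin

text \<open>Only the walls are constrained. That the remaining hyperplanes have constant sign too,
  so that this is a cell of the arrangement, is \<open>face_eq_cell\<close>.\<close>

definition face :: "'a \<Rightarrow> 'a set set \<Rightarrow> 'a set" where
  "face x S = {y. (\<forall>H\<in>S. nrm x H \<bullet> y = 0) \<and> (\<forall>H\<in>walls x - S. 0 < nrm x H \<bullet> y)}"

lemma wall_normals:
  assumes x: "generic x" and S: "S \<subseteq> walls x"
  shows "finite (nrm x ` S)"
    and "\<And>m n. m \<in> nrm x ` S \<Longrightarrow> n \<in> nrm x ` S \<Longrightarrow> m \<noteq> n \<Longrightarrow> m \<bullet> n \<le> 0"
    and "\<And>n. n \<in> nrm x ` S \<Longrightarrow> 0 < n \<bullet> x"
proof -
  show "finite (nrm x ` S)" using finite_subset[OF S finite_walls] by simp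
  show "m \<bullet> n \<le> 0" if "m \<in> nrm x ` S" "n \<in> nrm x ` S" "m \<noteq> n" for m n
    using that obtuse[OF x] S by blast
  show "0 < n \<bullet> x" if "n \<in> nrm x ` S" for n
    using that nrm_self[OF x] S walls_subset by blast
qed

lemma inj_on_nrm:
  assumes x: "generic x"
  shows "inj_on (nrm x) (walls x)"
proof (rule inj_onI, rule ccontr)
  fix H K assume HK: "H \<in> walls x" "K \<in> walls x" "nrm x H = nrm x K" "H \<noteq> K"
  then have "nrm x H \<bullet> nrm x H \<le> 0" using obtuse[OF x HK(1,2,4)] by simp
  then have "nrm x H = 0" by (metis inner_eq_zero_iff inner_ge_zero order_antisym)
  moreover have "0 < nrm x H \<bullet> x" using nrm_self[OF x] HK(1) walls_subset by blast
  ultimately show False by simp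
qed

text \<open>Passing from y to p subtracts nonnegative multiples of normals in S. The other wall
  normals are obtuse to these, so their values can only grow.\<close>

lemma project_to_face:
  assumes x: "generic x" and S: "S \<subseteq> walls x" and y: "y \<in> closed_chamber x"
  shows "\<exists>e p. y = (\<Sum>m\<in>nrm x ` S. e m *\<^sub>R m) + p \<and> (\<forall>m\<in>nrm x ` S. 0 \<le> e m) \<and>
    (\<forall>H\<in>S. nrm x H \<bullet> p = 0) \<and> (\<forall>H\<in>walls x - S. nrm x H \<bullet> y \<le> nrm x H \<bullet> p)"
proof -
  have "0 \<le> n \<bullet> y" if "n \<in> nrm x ` S" for n
    using that y S walls_subset by (fastforce simp: closed_chamber_def)
  then obtain e p where ep: "y = (\<Sum>m\<in>nrm x ` S. e m *\<^sub>R m) + p"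
    "\<And>m. m \<in> nrm x ` S \<Longrightarrow> 0 \<le> e m" "\<And>m. m \<in> nrm x ` S \<Longrightarrow> m \<bullet> p = 0"
    using obtuse_projection[OF wall_normals[OF x S], of y] by blast
  have "nrm x H \<bullet> y \<le> nrm x H \<bullet> p" if H: "H \<in> walls x - S" for H
  proof -
    have "nrm x H \<bullet> (\<Sum>m\<in>nrm x ` S. e m *\<^sub>R m) \<le> 0"
      unfolding inner_sum_right
    proof (rule sum_nonpos)
      fix m assume m: "m \<in> nrm x ` S"
      then obtain K where "K \<in> S" "m = nrm x K" by blast
      then have "nrm x H \<bullet> m \<le> 0" using obtuse[OF x, of H K] H S by blast
      then show "nrm x H \<bullet> e m *\<^sub>R m \<le> 0" using ep(2)[OF m] by (simp add: mult_nonneg_nonpos)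
    qed
    then show ?thesis unfolding ep(1) by (simp add: inner_add_right)
  qed
  then show ?thesis using ep by (intro exI[of _ e] exI[of _ p]) auto
qed

text \<open>The projection of x itself is a point of the face: the walls outside S are strict at x
  and their values do not decrease.\<close>

lemma face_nonempty:
  assumes x: "generic x" and S: "S \<subseteq> walls x"
  shows "face x S \<noteq> {}"
proof -
  have "x \<in> closed_chamber x" using chamber_self[OF x] chamber_subset by blast
  then obtain e p where p: "\<And>H. H \<in> S \<Longrightarrow> nrm x H \<bullet> p = 0"
    "\<And>H. H \<in> walls x - S \<Longrightarrow> nrm x H \<bullet> x \<le> nrm x H \<bullet> p"
    using project_to_face[OF x S, of x] by auto
  have "0 < nrm x H \<bullet> p" if "H \<in> walls x - S" for H
    using p(2)[OF that] nrm_self[OF x] that walls_subset by (metis DiffD1 less_le_trans subsetD)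
  then have "p \<in> face x S" using p(1) by (simp add: face_def)
  then show ?thesis by blast
qed

lemma face_subset_closed_chamber:
  assumes x: "generic x"
  shows "face x S \<subseteq> closed_chamber x"
proof
  fix y assume y: "y \<in> face x S"
  show "y \<in> closed_chamber x"
  proof (rule walls_determine_closed[OF x])
    fix H assume "H \<in> walls x"
    then show "0 \<le> nrm x H \<bullet> y" using y by (cases "H \<in> S") (auto simp: face_def less_imp_le)
  qed
qed

lemma face_step:
  assumes x: "generic x" and q: "q \<in> face x S" and y: "\<And>H. H \<in> S \<Longrightarrow> nrm x H \<bullet> y = 0"
  obtains \<epsilon> where "\<epsilon> > 0" "\<And>t. \<bar>t\<bar> \<le> \<epsilon> \<Longrightarrow> q + t *\<^sub>R y \<in> face x S"
proof -
  obtain d where d: "d > 0" "\<And>t K. \<bar>t\<bar> \<le> d \<Longrightarrow> K \<in> walls x \<Longrightarrow> nrm x K \<bullet> q \<noteq> 0 \<Longrightarrow>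
      sgn (nrm x K \<bullet> (q + t *\<^sub>R y)) = sgn (nrm x K \<bullet> q)"
    using sgn_perturb[OF finite_walls[of x], of "nrm x" q y] by auto
  have "q + t *\<^sub>R y \<in> face x S" if t: "\<bar>t\<bar> \<le> d" for t
  proof -
    have "0 < nrm x H \<bullet> (q + t *\<^sub>R y)" if H: "H \<in> walls x - S" for H
    proof -
      have "0 < nrm x H \<bullet> q" using q H by (simp add: face_def)
      then show ?thesis using d(2)[OF t, of H] H by (simp add: sgn_1_pos)
    qed
    moreover have "nrm x H \<bullet> (q + t *\<^sub>R y) = 0" if "H \<in> S" for H
      using q y that by (simp add: face_def inner_add_right)
    ultimately show ?thesis by (simp add: face_def)
  qed
  then show ?thesis using that d(1) by blast
qed

text \<open>The segment from q' to q can be prolonged a little beyond q inside the closed chamber. A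
  form that is nonnegative there and zero at q must vanish at q' as well.\<close>

lemma face_zero:
  assumes x: "generic x" and q: "q \<in> face x S" "q' \<in> face x S" and H: "H \<in> A" "a H \<bullet> q = 0"
  shows "a H \<bullet> q' = 0"
proof -
  have "nrm x K \<bullet> (q' - q) = 0" if "K \<in> S" for K
    using q that by (simp add: face_def inner_diff_right)
  then obtain d where d: "d > 0" "\<And>t. \<bar>t\<bar> \<le> d \<Longrightarrow> q + t *\<^sub>R (q' - q) \<in> face x S"
    using face_step[OF x q(1)] by blast
  then have "q + (- d) *\<^sub>R (q' - q) \<in> closed_chamber x"
    using face_subset_closed_chamber[OF x] by (metis abs_minus_cancel abs_of_pos order_refl subsetD)
  then have "0 \<le> nrm x H \<bullet> (q + (- d) *\<^sub>R (q' - q))" using H(1) by (simp add: closed_chamber_def)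
  moreover have "nrm x H \<bullet> q = 0" using nrm_zero_iff[OF x H(1)] H(2) by simp
  ultimately have "d * (nrm x H \<bullet> q') \<le> 0" by (simp add: inner_diff_right)
  then have "nrm x H \<bullet> q' \<le> 0" using d(1) by (simp add: mult_le_0_iff)
  moreover have "0 \<le> nrm x H \<bullet> q'"
    using face_subset_closed_chamber[OF x] q(2) H(1) by (auto simp: closed_chamber_def)
  ultimately show ?thesis using nrm_zero_iff[OF x H(1)] by simp
qed

lemma sgn_nrm: "sgn (nrm x H \<bullet> y) = sgn (a H \<bullet> x) * sgn (a H \<bullet> y)"
  by (simp add: nrm_def sgn_mult)

lemma face_eq_cell:
  assumes x: "generic x" and S: "S \<subseteq> walls x" and q: "q \<in> face x S"
  shows "face x S = cell UNIV a A q"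
proof (intro equalityI subsetI)
  fix y assume y: "y \<in> cell UNIV a A q"
  then have "sgn (nrm x H \<bullet> y) = sgn (nrm x H \<bullet> q)" if "H \<in> A" for H
    using that by (simp add: sgn_nrm cell_def)
  moreover have "S \<subseteq> A" "walls x - S \<subseteq> A" using S walls_subset by blast+
  ultimately have sg: "sgn (nrm x H \<bullet> y) = sgn (nrm x H \<bullet> q)" if "H \<in> S \<or> H \<in> walls x - S" for H
    using that by blast
  have "nrm x H \<bullet> y = 0" if "H \<in> S" for H
    using sg[of H] q that by (simp add: face_def sgn_0_0)
  moreover have "0 < nrm x H \<bullet> y" if "H \<in> walls x - S" for H
    using sg[of H] q that by (simp add: face_def sgn_1_pos)
  ultimately show "y \<in> face x S" by (simp add: face_def)
next
  fix y assume y: "y \<in> face x S"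
  have "sgn (a H \<bullet> y) = sgn (a H \<bullet> q)" if H: "H \<in> A" for H
  proof (cases "a H \<bullet> q = 0")
    case True
    then show ?thesis using face_zero[OF x q y H] by simp
  next
    case False
    then have "a H \<bullet> y \<noteq> 0" using face_zero[OF x y q H] by blast
    then have "nrm x H \<bullet> q \<noteq> 0" "nrm x H \<bullet> y \<noteq> 0" using False nrm_zero_iff[OF x H] by auto
    moreover have "0 \<le> nrm x H \<bullet> q" "0 \<le> nrm x H \<bullet> y"
      using face_subset_closed_chamber[OF x] q y H by (auto simp: closed_chamber_def)
    ultimately have "0 < nrm x H \<bullet> q" "0 < nrm x H \<bullet> y" by auto
    then show ?thesis using nrm_pos_iff[OF x H] by simp
  qed
  then show "y \<in> cell UNIV a A q" by (simp add: cell_def)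
qed

text \<open>The span is the orthogonal complement of the normals of S, which are distinct and
  independent by obtuseness.\<close>

lemma codim_face:
  assumes x: "generic x" and S: "S \<subseteq> walls x"
  shows "codim (span (face x S)) = card S"
proof -
  let ?N = "nrm x ` S" and ?L = "{y. \<forall>H\<in>S. nrm x H \<bullet> y = 0}"
  obtain q where q: "q \<in> face x S" using face_nonempty[OF x S] by blast
  have "span (face x S) = ?L"
  proof (rule span_eq_subspace_from_steps[OF _ _ q])
    show "subspace ?L" by (auto simp: subspace_def inner_add_right)
    show "face x S \<subseteq> ?L" by (auto simp: face_def)
    fix y assume "y \<in> ?L"
    then obtain e where "e > 0" "\<And>t. \<bar>t\<bar> \<le> e \<Longrightarrow> q + t *\<^sub>R y \<in> face x S"
      using face_step[OF x q] by blast
    then have "e > 0 \<and> q + e *\<^sub>R y \<in> face x S" by simp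
    then show "\<exists>\<epsilon>>0. q + \<epsilon> *\<^sub>R y \<in> face x S" by blast
  qed
  moreover have "?L = {y \<in> UNIV. \<forall>z\<in>span ?N. orthogonal z y}"
  proof (intro equalityI subsetI)
    fix y assume "y \<in> ?L"
    then have "orthogonal y n" if "n \<in> ?N" for n using that by (auto simp: orthogonal_def inner_commute)
    then have "orthogonal y z" if "z \<in> span ?N" for z using that by (rule orthogonal_to_span[rotated])
    then show "y \<in> {y \<in> UNIV. \<forall>z\<in>span ?N. orthogonal z y}" by (simp add: orthogonal_commute)
  next
    fix y assume "y \<in> {y \<in> UNIV. \<forall>z\<in>span ?N. orthogonal z y}"
    then show "y \<in> ?L" by (auto simp: orthogonal_def span_base)
  qed
  moreover have "dim {y \<in> UNIV. \<forall>z\<in>span ?N. orthogonal z y} + dim (span ?N) = dim (UNIV :: 'a set)"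
    by (rule dim_subspace_orthogonal_to_vectors) auto
  moreover have "dim (span ?N) = card S"
    using dim_eq_card_independent[OF obtuse_independent[OF wall_normals[OF x S]]]
      card_image[OF inj_on_subset[OF inj_on_nrm[OF x] S]] by simp
  ultimately show ?thesis unfolding codim_def by simp
qed

lemma nrm_descent: "H \<in> neg x \<Longrightarrow> nrm x H \<bullet> v < 0"
  using base_pos by (auto simp: neg_def nrm_def)

text \<open>A face recovers its chamber: move slightly from the face in direction \<open>- v\<close>.\<close>

lemma chamber_near_face:
  assumes x: "generic x" and S: "S \<subseteq> walls x \<inter> neg x" and q: "q \<in> face x S"
  obtains \<epsilon> where "\<epsilon> > 0" "\<And>t. 0 < t \<Longrightarrow> t \<le> \<epsilon> \<Longrightarrow> q + t *\<^sub>R (- v) \<in> chamber x"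
proof -
  obtain d where d: "d > 0" "\<And>t K. \<bar>t\<bar> \<le> d \<Longrightarrow> K \<in> walls x \<Longrightarrow> nrm x K \<bullet> q \<noteq> 0 \<Longrightarrow>
      sgn (nrm x K \<bullet> (q + t *\<^sub>R (- v))) = sgn (nrm x K \<bullet> q)"
    using sgn_perturb[OF finite_walls[of x], of "nrm x" q "- v"] by auto
  have "q + t *\<^sub>R (- v) \<in> chamber x" if t: "0 < t" "t \<le> d" for t
  proof (rule walls_determine[OF x])
    fix H assume H: "H \<in> walls x"
    show "0 < nrm x H \<bullet> (q + t *\<^sub>R (- v))"
    proof (cases "H \<in> S")
      case True
      then have "nrm x H \<bullet> v < 0" using S nrm_descent by blast
      then show ?thesis using True q t by (simp add: face_def inner_diff_right mult_pos_neg)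
    next
      case False
      then have "0 < nrm x H \<bullet> q" using q H by (simp add: face_def)
      then show ?thesis using H t d(2)[of t H] by (simp add: sgn_1_pos)
    qed
  qed
  then show ?thesis using that d(1) by blast
qed

lemma face_determines:
  assumes x: "generic x" and S: "S \<subseteq> walls x \<inter> neg x"
    and x': "generic x'" and S': "S' \<subseteq> walls x' \<inter> neg x'"
    and eq: "face x S = face x' S'"
  shows "closed_chamber x = closed_chamber x'"
proof -
  obtain q where q: "q \<in> face x S" using face_nonempty[OF x] S by blast
  obtain d where d: "d > 0" "\<And>t. 0 < t \<Longrightarrow> t \<le> d \<Longrightarrow> q + t *\<^sub>R (- v) \<in> chamber x"
    using chamber_near_face[OF x S q] by blast
  obtain d' where d': "d' > 0" "\<And>t. 0 < t \<Longrightarrow> t \<le> d' \<Longrightarrow> q + t *\<^sub>R (- v) \<in> chamber x'"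
    using chamber_near_face[OF x' S'] q eq by blast
  define w where "w = q + min d d' *\<^sub>R (- v)"
  have "w \<in> chamber x" "w \<in> chamber x'"
    unfolding w_def using d(1) d'(1) by (intro d(2) d'(2); simp)+
  then have "sgn (a H \<bullet> x) = sgn (a H \<bullet> x')" if "H \<in> A" for H
    using that nrm_pos_iff[OF x] nrm_pos_iff[OF x'] by (simp add: chamber_def)
  then show ?thesis by (rule closed_chamber_cong)
qed

lemma face_descents:
  assumes "q \<in> face x S" "S \<subseteq> walls x"
  shows "S = {H \<in> walls x. nrm x H \<bullet> q = 0}"
proof (intro equalityI subsetI)
  fix H assume "H \<in> {H \<in> walls x. nrm x H \<bullet> q = 0}"
  then show "H \<in> S" using assms(1) unfolding face_def by (metis (mono_tags, lifting) DiffI less_irrefl mem_Collect_eq)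
qed (use assms in \<open>auto simp: face_def\<close>)

text \<open>This is where sharpness enters: the chamber is contained in the sum of the closure of the
  face and the cone spanned by the normals of the walls in \<open>S\<close>, on which \<open>v\<close> is negative.\<close>

lemma chamber_halfspace_iff:
  assumes x: "generic x" and S: "S \<subseteq> walls x \<inter> neg x"
  shows "closed_chamber x \<subseteq> {y. y \<bullet> v \<le> 0} \<longleftrightarrow> face x S \<subseteq> {y. y \<bullet> v \<le> 0}"
proof
  assume "closed_chamber x \<subseteq> {y. y \<bullet> v \<le> 0}"
  then show "face x S \<subseteq> {y. y \<bullet> v \<le> 0}" using face_subset_closed_chamber[OF x] by blast
next
  assume F: "face x S \<subseteq> {y. y \<bullet> v \<le> 0}"
  have Sw: "S \<subseteq> walls x" using S by blast
  obtain f where f: "f \<in> face x S" using face_nonempty[OF x Sw] by blast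
  show "closed_chamber x \<subseteq> {y. y \<bullet> v \<le> 0}"
  proof
    fix y assume y: "y \<in> closed_chamber x"
    obtain e p where y_eq: "y = (\<Sum>m\<in>nrm x ` S. e m *\<^sub>R m) + p"
      and e: "\<forall>m\<in>nrm x ` S. 0 \<le> e m"
      and p: "\<forall>H\<in>S. nrm x H \<bullet> p = 0" "\<forall>H\<in>walls x - S. nrm x H \<bullet> y \<le> nrm x H \<bullet> p"
      using project_to_face[OF x Sw y] by (elim exE conjE) (rule that)
    \<comment> \<open>The point p may violate strictness at walls outside S, so a multiple of a
      point f of the face is added and then shrunk to 0.\<close>
    have "0 \<le> - (p \<bullet> v) + t * (- (f \<bullet> v))" if "0 < t" for t
    proof -
      have "0 < nrm x H \<bullet> (p + t *\<^sub>R f)" if H: "H \<in> walls x - S" for H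
      proof -
        have "0 \<le> nrm x H \<bullet> y" using y H walls_subset by (auto simp: closed_chamber_def)
        moreover have "0 < t * (nrm x H \<bullet> f)" using f H \<open>0 < t\<close> by (simp add: face_def)
        ultimately show ?thesis using bspec[OF p(2) H] by (simp add: inner_add_right)
      qed
      then have "p + t *\<^sub>R f \<in> face x S" using p(1) f by (simp add: face_def inner_add_right)
      then have "(p + t *\<^sub>R f) \<bullet> v \<le> 0" using F by blast
      then show ?thesis by (simp add: inner_add_left)
    qed
    then have "0 \<le> - (p \<bullet> v)" by (rule affine_nonneg_at_zero)
    moreover have "(\<Sum>m\<in>nrm x ` S. e m *\<^sub>R m) \<bullet> v \<le> 0"
      unfolding inner_sum_left
    proof (rule sum_nonpos)
      fix m assume m: "m \<in> nrm x ` S"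
      then have "m \<bullet> v < 0" using S nrm_descent by blast
      then show "(e m *\<^sub>R m) \<bullet> v \<le> 0" using bspec[OF e m] by (simp add: mult_nonneg_nonpos)
    qed
    ultimately show "y \<in> {y. y \<bullet> v \<le> 0}" unfolding y_eq by (simp add: inner_add_left)
  qed
qed

text \<open>A small step from f against v makes the forms that vanish at f negative and keeps all
  other signs; the walls through f are therefore descents. Every representative x' of the chamber is
  covered because \<open>rep\<close> later picks an arbitrary one.\<close>

lemma cell_is_descent_face:
  obtains x where "generic x"
    "\<And>x'. generic x' \<Longrightarrow> closed_chamber x' = closed_chamber x \<Longrightarrow>
      \<exists>S \<subseteq> walls x' \<inter> neg x'. f \<in> face x' S"
proof -
  obtain d where d: "d > 0" "\<And>t H. \<bar>t\<bar> \<le> d \<Longrightarrow> H \<in> A \<Longrightarrow> a H \<bullet> f \<noteq> 0 \<Longrightarrow>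
      sgn (a H \<bullet> (f + t *\<^sub>R (- v))) = sgn (a H \<bullet> f)"
    using sgn_perturb[OF finite_A, of a f "- v"] by auto
  define x where "x = f + d *\<^sub>R (- v)"
  have same: "sgn (a H \<bullet> x) = sgn (a H \<bullet> f)" if "H \<in> A" "a H \<bullet> f \<noteq> 0" for H
    using d(2)[of d H] d(1) that by (simp add: x_def)
  have neg0: "a H \<bullet> x < 0" if "H \<in> A" "a H \<bullet> f = 0" for H
    using d(1) base_pos[OF that(1)] that(2) by (simp add: x_def inner_diff_right)
  have x: "generic x"
    unfolding generic_def using same neg0 by (metis less_irrefl sgn_0_0 sgn_0)
  show ?thesis
  proof
    show "generic x" by fact
    fix x' assume x': "generic x'" "closed_chamber x' = closed_chamber x"
    then have "x \<in> closed_chamber x'" using chamber_self[OF x] chamber_subset by blast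
    then have sg: "sgn (a H \<bullet> x) = sgn (a H \<bullet> x')" if "H \<in> A" for H
      using generic_in_closed_chamber[OF x'(1) x] that by blast
    let ?S = "{H \<in> walls x'. a H \<bullet> f = 0}"
    have "?S \<subseteq> walls x' \<inter> neg x'"
      using neg0 sg walls_subset by (auto simp: neg_def) (metis sgn_less subsetD)
    moreover have "f \<in> face x' ?S"
    proof -
      have "nrm x' H \<bullet> f = 0" if "H \<in> ?S" for H using that by (simp add: nrm_def)
      moreover have "0 < nrm x' H \<bullet> f" if "H \<in> walls x' - ?S" for H
        using that nrm_pos_iff[OF x'(1), of H f] same[of H] sg[of H] walls_subset by auto
      ultimately show ?thesis by (simp add: face_def)
    qed
    ultimately show "\<exists>S \<subseteq> walls x' \<inter> neg x'. f \<in> face x' S" by blast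
  qed
qed

section \<open>Regions and faces in the half-space\<close>

definition rep :: "'a set \<Rightarrow> 'a" where
  "rep C = (SOME x. generic x \<and> closed_chamber x = C)"

lemma rep:
  assumes "C \<in> regions A"
  shows "generic (rep C)" "closed_chamber (rep C) = C"
proof -
  have "\<exists>x. generic x \<and> closed_chamber x = C" using assms by (auto simp: regions_eq)
  then have "generic (rep C) \<and> closed_chamber (rep C) = C" unfolding rep_def by (rule someI_ex)
  then show "generic (rep C)" "closed_chamber (rep C) = C" by auto
qed

definition descents :: "'a set \<Rightarrow> 'a set set" where
  "descents C = walls (rep C) \<inter> neg (rep C)"

definition low_cells :: "'a set set" where
  "low_cells = {F \<in> cells UNIV a A. F \<subseteq> {y. y \<bullet> v \<le> 0}}"

definition low_regions :: "'a set set" where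
  "low_regions = {C \<in> regions A. C \<subseteq> {y. y \<bullet> v \<le> 0}}"

text \<open>A face determines its chamber (\<open>face_determines\<close>) and then S, as the walls
  vanishing on it. \<open>chamber_halfspace_iff\<close> makes membership in the half-space
  equivalent for the face and the region, so the correspondence restricts to the low ones on both
  sides.\<close>

lemma bij_descents_low_cells:
  "bij_betw (\<lambda>(C, S). face (rep C) S) (SIGMA C:low_regions. Pow (descents C)) low_cells"
  unfolding bij_betw_def
proof
  let ?P = "SIGMA C:low_regions. Pow (descents C)"
  have P: "generic (rep C)" "closed_chamber (rep C) = C" "S \<subseteq> walls (rep C) \<inter> neg (rep C)" "S \<subseteq> walls (rep C)"
    "C \<subseteq> {y. y \<bullet> v \<le> 0}"
    if "(C, S) \<in> ?P" for C S
    using that rep[of C] by (auto simp: low_regions_def descents_def)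
  show "inj_on (\<lambda>(C, S). face (rep C) S) ?P"
  proof (rule inj_onI, clarify)
    fix C S C' S' assume CS: "C \<in> low_regions" "S \<subseteq> descents C" "C' \<in> low_regions" "S' \<subseteq> descents C'"
      and eq: "face (rep C) S = face (rep C') S'"
    then have m: "(C, S) \<in> ?P" "(C', S') \<in> ?P" by auto
    have CC: "C = C'" using face_determines[OF P(1,3)[OF m(1)] P(1,3)[OF m(2)] eq] P(2)[OF m(1)] P(2)[OF m(2)] by simp
    obtain q where q: "q \<in> face (rep C) S" using face_nonempty[OF P(1,4)[OF m(1)]] by blast
    have "S = {H \<in> walls (rep C). nrm (rep C) H \<bullet> q = 0}" using face_descents[OF q P(4)[OF m(1)]] .
    moreover have "S' = {H \<in> walls (rep C'). nrm (rep C') H \<bullet> q = 0}"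
      using face_descents[OF _ P(4)[OF m(2)]] q eq by blast
    ultimately show "C = C' \<and> S = S'" using CC by simp
  qed
  show "(\<lambda>(C, S). face (rep C) S) ` ?P = low_cells"
  proof (intro equalityI subsetI)
    fix F assume "F \<in> (\<lambda>(C, S). face (rep C) S) ` ?P"
    then obtain C S where m: "(C, S) \<in> ?P" and F: "F = face (rep C) S" by auto
    obtain q where q: "q \<in> F" using face_nonempty[OF P(1,4)[OF m]] F by blast
    then have "F = cell UNIV a A q" using face_eq_cell[OF P(1,4)[OF m]] F by blast
    moreover have "F \<subseteq> {y. y \<bullet> v \<le> 0}"
      using chamber_halfspace_iff[OF P(1,3)[OF m]] P(2,5)[OF m] F by simp
    ultimately show "F \<in> low_cells" by (auto simp: low_cells_def cells_def)
  next
    fix F assume "F \<in> low_cells"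
    then obtain f where F: "F = cell UNIV a A f" "F \<subseteq> {y. y \<bullet> v \<le> 0}" by (auto simp: low_cells_def cells_def)
    obtain x where x: "generic x" "\<And>x'. generic x' \<Longrightarrow> closed_chamber x' = closed_chamber x \<Longrightarrow>
        \<exists>S \<subseteq> walls x' \<inter> neg x'. f \<in> face x' S"
      using cell_is_descent_face by metis
    define C where "C = closed_chamber x"
    have "C \<in> regions A" using x(1) by (simp add: C_def regions_eq)
    note r = rep[OF this]
    obtain S where S: "S \<subseteq> walls (rep C) \<inter> neg (rep C)" "f \<in> face (rep C) S"
      using x(2)[OF r(1)] r(2) C_def by blast
    then have "F = face (rep C) S" using face_eq_cell[OF r(1) _ S(2)] F(1) by simp
    moreover from this have "C \<subseteq> {y. y \<bullet> v \<le> 0}"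
      using chamber_halfspace_iff[OF r(1) S(1)] r(2) F(2) by simp
    then have "(C, S) \<in> ?P" using S(1) \<open>C \<in> regions A\<close> by (simp add: low_regions_def descents_def)
    ultimately show "F \<in> (\<lambda>(C, S). face (rep C) S) ` ?P" by force
  qed
qed

end

subsection \<open>Counting low cells by flats\<close>

context obtuse_arrangement
begin

lemma finite_low_cells: "finite low_cells"
  unfolding low_cells_def by (rule finite_subset[OF _ finite_cells[OF finite_A, of UNIV a]]) blast

lemma finite_low_regions: "finite low_regions"
proof -
  have "low_regions \<subseteq> closed_chamber ` {x. generic x}" by (auto simp: low_regions_def regions_eq)
  \<comment> \<open>A region is determined by its inversion set, a subset of A.\<close>
  also have "\<dots> \<subseteq> (\<lambda>W. {y. \<forall>H\<in>A. 0 \<le> (if H \<in> W then - a H else a H) \<bullet> y}) ` Pow A"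
  proof
    fix C assume "C \<in> closed_chamber ` {x. generic x}"
    then obtain x where x: "generic x" "C = closed_chamber x" by blast
    have "nrm x H = (if H \<in> neg x then - a H else a H)" if "H \<in> A" for H
      using x(1) that by (auto simp: nrm_def neg_def generic_def sgn_if)
    then have "C = {y. \<forall>H\<in>A. 0 \<le> (if H \<in> neg x then - a H else a H) \<bullet> y}"
      unfolding x(2) closed_chamber_def by (intro Collect_cong ball_cong refl) simp
    then show "C \<in> (\<lambda>W. {y. \<forall>H\<in>A. 0 \<le> (if H \<in> W then - a H else a H) \<bullet> y}) ` Pow A"
      using neg_subset by blast
  qed
  finally show ?thesis by (rule finite_subset) (simp add: finite_A)
qed

lemma finite_flats: "finite (flats A)"
proof -
  have "flats A = Inter ` Pow A" by (auto simp: flats_def)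
  then show ?thesis using finite_A by simp
qed

lemma flat_subspace:
  assumes "X \<in> flats A"
  shows "subspace X"
proof -
  obtain S where S: "S \<subseteq> A" "X = \<Inter>S" using assms by (auto simp: flats_def)
  have "subspace H" if "H \<in> S" for H
    using hyperplane_eq[of H] subspace_hyperplane[of "a H"] that S(1) by auto
  then show ?thesis unfolding S(2) by (intro subspace_Inter ballI)
qed

lemma span_cell_flat: "span (cell UNIV a A x) \<in> flats A"
proof -
  have "span (cell UNIV a A x) = \<Inter>{H \<in> A. a H \<bullet> x = 0}"
    unfolding span_cell[OF subspace_UNIV finite_A UNIV_I] using mem_hyperplane by auto
  then show ?thesis by (auto simp: flats_def)
qed

text \<open>A cell through a point of X has sign 0 on every hyperplane defining X, so it stays in X;
  restricting to X creates no new cells.\<close>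

lemma cells_in_flat:
  assumes X: "X \<in> flats A"
  shows "cells X a A = {F \<in> cells UNIV a A. span F \<subseteq> X}"
proof -
  obtain S where S: "S \<subseteq> A" "X = \<Inter>S" using X by (auto simp: flats_def)
  have mem_X: "y \<in> X \<longleftrightarrow> (\<forall>H\<in>S. a H \<bullet> y = 0)" for y
    using S mem_hyperplane by blast
  have cell_X: "cell UNIV a A x = cell X a A x" "span (cell UNIV a A x) \<subseteq> X" if "x \<in> X" for x
  proof -
    have sub: "y \<in> X" if y: "y \<in> cell UNIV a A x" for y
      unfolding mem_X
    proof
      fix H assume H: "H \<in> S"
      then have "sgn (a H \<bullet> y) = sgn (a H \<bullet> x)" "a H \<bullet> x = 0"
        using y S(1) \<open>x \<in> X\<close> mem_X[of x] by (auto simp: cell_def)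
      then show "a H \<bullet> y = 0" by (simp add: sgn_0_0)
    qed
    then show "cell UNIV a A x = cell X a A x" by (auto simp: cell_def)
    show "span (cell UNIV a A x) \<subseteq> X" by (rule span_minimal[OF subsetI[OF sub] flat_subspace[OF X]])
  qed
  have "x \<in> X" if "span (cell UNIV a A x) \<subseteq> X" for x
    using that cell_self[of x UNIV a A] span_base by blast
  then have "{F \<in> cells UNIV a A. span F \<subseteq> X} = cell UNIV a A ` X"
    using cell_X(2) by (auto simp: cells_def)
  also have "\<dots> = cells X a A" unfolding cells_def by (intro image_cong refl cell_X(1))
  finally show ?thesis by simp
qed

definition low_count :: "'a set \<Rightarrow> nat" where
  "low_count X = card {F \<in> low_cells. span F = X}"

lemma low_cell_flat: "F \<in> low_cells \<Longrightarrow> span F \<in> flats A"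
  using span_cell_flat by (auto simp: low_cells_def cells_def)

text \<open>The left side groups the low cells inside X by their span; ungrouped, it is the total
  half-space weight on X.\<close>

lemma sum_low_count:
  assumes X: "X \<in> flats A"
  shows "(\<Sum>Y\<in>{Y \<in> flats A. Y \<subseteq> X}. (- 1) ^ dim Y * int (low_count Y))
    = (if X \<subseteq> {x. x \<bullet> v = 0} then (- 1) ^ dim X else 0)"
proof -
  let ?T = "{Y \<in> flats A. Y \<subseteq> X}" and ?S = "{F \<in> low_cells. span F \<subseteq> X}"
  have "(\<Sum>Y\<in>?T. (- 1) ^ dim Y * int (low_count Y)) = (\<Sum>Y\<in>?T. \<Sum>F\<in>{F \<in> ?S. span F = Y}. (- 1) ^ dim F)"
  proof (rule sum.cong[OF refl])
    fix Y assume "Y \<in> ?T"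
    then have "{F \<in> ?S. span F = Y} = {F \<in> low_cells. span F = Y}" by auto
    moreover have "(\<Sum>F\<in>{F \<in> low_cells. span F = Y}. (- 1) ^ dim F) = (\<Sum>F\<in>{F \<in> low_cells. span F = Y}. (- 1 :: int) ^ dim Y)"
    proof (rule sum.cong[OF refl])
      fix F assume "F \<in> {F \<in> low_cells. span F = Y}"
      then have "dim F = dim Y" by (metis (mono_tags, lifting) dim_span mem_Collect_eq)
      then show "(- 1 :: int) ^ dim F = (- 1) ^ dim Y" by simp
    qed
    ultimately show "(- 1) ^ dim Y * int (low_count Y) = (\<Sum>F\<in>{F \<in> ?S. span F = Y}. (- 1) ^ dim F)"
      by (simp add: low_count_def)
  qed
  also have "\<dots> = (\<Sum>F\<in>?S. (- 1) ^ dim F)"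
    using finite_low_cells finite_flats low_cell_flat by (intro sum.group) auto
  also have "\<dots> = (\<Sum>F\<in>cells X a A. halfspace_weight v F)"
  proof (rule sum.mono_neutral_cong_left)
    show "finite (cells X a A)" by (rule finite_cells[OF finite_A])
    show "?S \<subseteq> cells X a A" unfolding cells_in_flat[OF X] by (auto simp: low_cells_def)
    show "\<forall>F\<in>cells X a A - ?S. halfspace_weight v F = 0"
      unfolding cells_in_flat[OF X] by (auto simp: low_cells_def halfspace_weight_def)
    fix F assume "F \<in> ?S"
    moreover have "F \<noteq> {}" if "F \<in> cells UNIV a A"
      using that cell_self[of _ UNIV a A] by (force simp: cells_def)
    ultimately show "(- 1) ^ dim F = halfspace_weight v F"
      by (auto simp: low_cells_def halfspace_weight_def)
  qed
  also have "\<dots> = (if X \<subseteq> {x. x \<bullet> v = 0} then (- 1) ^ dim X else 0)"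
    by (rule sum_halfspace_weight_cells[OF flat_subspace[OF X] finite_A])
  finally show ?thesis .
qed

lemma bottom_flat_least: "X \<in> flats A \<Longrightarrow> bottom_flat A \<subseteq> X"
  by (auto simp: flats_def bottom_flat_def)

text \<open>By \<open>sum_low_count\<close> the signed counts sum to 0 below every flat other than
  the bottom, which is the Moebius recursion. The factor for the bottom flat normalizes the value
  there to 1.\<close>

lemma mobius_eq_low_count:
  assumes gen: "\<And>X. X \<in> flats A \<Longrightarrow> X \<subseteq> {x. x \<bullet> v = 0} \<longleftrightarrow> X = bottom_flat A"
    and "X \<in> flats A"
  shows "mobius (flats A) (bottom_flat A) X = (- 1) ^ dim X * (- 1) ^ dim (bottom_flat A) * int (low_count X)"
  using \<open>X \<in> flats A\<close>
proof (induction "dim X" arbitrary: X rule: less_induct)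
  case less
  let ?b = "bottom_flat A"
  let ?Z = "{z \<in> flats A. ?b \<subseteq> z \<and> z \<subset> X}"
  have "{Y \<in> flats A. Y \<subseteq> X} = insert X ?Z" using less.prems bottom_flat_least by auto
  then have "(- 1) ^ dim X * int (low_count X) + (\<Sum>Y\<in>?Z. (- 1) ^ dim Y * int (low_count Y))
      = (if X = ?b then (- 1) ^ dim X else 0)"
    using sum_low_count[OF less.prems] gen[OF less.prems] finite_flats by simp
  note sum = this
  show ?case
  proof (cases "X = ?b")
    case True
    then have Z: "?Z = {}" by auto
    have "int (low_count X) = 1" using sum unfolding Z using True by simp
    then show ?thesis using True by (simp add: mobius.simps)
  next
    case False
    have IH: "mobius (flats A) ?b z = (- 1) ^ dim z * (- 1) ^ dim ?b * int (low_count z)" if z: "z \<in> ?Z" for z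
    proof (rule less.hyps)
      have "span z = z" "span X = X" using z less.prems flat_subspace by (auto simp: span_eq_iff)
      then have "span z \<subset> span X" using z by (metis (mono_tags, lifting) mem_Collect_eq)
      then show "dim z < dim X" by (rule dim_psubset)
      show "z \<in> flats A" using z by simp
    qed
    have "mobius (flats A) ?b X = - (\<Sum>z\<in>?Z. mobius (flats A) ?b z)"
      using False less.prems bottom_flat_least[OF less.prems] finite_flats
      by (subst mobius.simps) simp
    also have "\<dots> = - (\<Sum>z\<in>?Z. (- 1) ^ dim ?b * ((- 1) ^ dim z * int (low_count z)))"
      using IH by (simp add: mult_ac)
    also have "\<dots> = - ((- 1) ^ dim ?b * (\<Sum>z\<in>?Z. (- 1) ^ dim z * int (low_count z)))"
      by (simp only: sum_distrib_left)
    also have "(\<Sum>z\<in>?Z. (- 1) ^ dim z * int (low_count z)) = - ((- 1) ^ dim X * int (low_count X))"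
      using sum False by simp
    finally show ?thesis by simp
  qed
qed

subsection \<open>The descent generating function\<close>

lemma monom_eq_sum_Pow:
  assumes "finite W"
  shows "monom (1::int) (card W) = (\<Sum>S\<in>Pow W. [:- 1, 1:] ^ card S)"
proof -
  have "monom (1::int) (card W) = [:0, 1:] ^ card W" by (simp add: monom_altdef)
  also have "[:0, 1::int:] = [:- 1, 1:] + 1" by (simp add: one_pCons)
  also have "([:- 1, 1::int:] + 1) ^ card W = (\<Prod>w\<in>W. [:- 1, 1:] + 1)" by simp
  also have "\<dots> = (\<Sum>S\<in>Pow W. (\<Prod>w\<in>S. [:- 1, 1:]) * (\<Prod>w\<in>W - S. 1))"
    by (rule prod_add[OF assms])
  finally show ?thesis by simp
qed

text \<open>Both sides sum over pairs of a low region and a set of its descents: the size of the set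
  is the codimension of the corresponding face, and the faces are then sorted by span.\<close>

lemma sum_low_regions:
  "(\<Sum>C\<in>low_regions. monom 1 (des A (region_of A v) C)) =
   (\<Sum>X\<in>flats A. smult (int (low_count X)) ([:- 1, 1:] ^ codim X))"
proof -
  let ?P = "SIGMA C:low_regions. Pow (descents C)"
  have fin: "finite (descents C)" for C using finite_walls by (simp add: descents_def)
  have "(\<Sum>C\<in>low_regions. monom 1 (des A (region_of A v) C)) =
      (\<Sum>C\<in>low_regions. \<Sum>S\<in>Pow (descents C). [:- 1, 1::int:] ^ card S)"
  proof (rule sum.cong[OF refl])
    fix C assume "C \<in> low_regions"
    then have "C \<in> regions A" by (simp add: low_regions_def)
    then have "des A (region_of A v) C = card (descents C)"
      using des_eq[OF rep(1)] rep(2) by (simp add: region_of_base descents_def)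
    then show "monom 1 (des A (region_of A v) C) = (\<Sum>S\<in>Pow (descents C). [:- 1, 1::int:] ^ card S)"
      using monom_eq_sum_Pow[OF fin] by simp
  qed
  also have "\<dots> = (\<Sum>p\<in>?P. [:- 1, 1::int:] ^ card (snd p))"
    using finite_low_regions fin by (subst sum.Sigma) (auto simp: case_prod_beta)
  also have "\<dots> = (\<Sum>p\<in>?P. [:- 1, 1::int:] ^ codim (span ((\<lambda>(C, S). face (rep C) S) p)))"
  proof (rule sum.cong[OF refl])
    fix p assume "p \<in> ?P"
    then have "fst p \<in> regions A" "snd p \<subseteq> walls (rep (fst p))"
      by (auto simp: low_regions_def descents_def)
    then show "[:- 1, 1::int:] ^ card (snd p) = [:- 1, 1:] ^ codim (span ((\<lambda>(C, S). face (rep C) S) p))"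
      using codim_face[OF rep(1)] by (simp add: case_prod_beta)
  qed
  also have "\<dots> = (\<Sum>F\<in>low_cells. [:- 1, 1::int:] ^ codim (span F))"
    by (rule sum.reindex_bij_betw[OF bij_descents_low_cells])
  also have "\<dots> = (\<Sum>X\<in>flats A. \<Sum>F\<in>{F \<in> low_cells. span F = X}. [:- 1, 1::int:] ^ codim (span F))"
    using finite_low_cells finite_flats low_cell_flat by (intro sum.group[symmetric]) auto
  also have "\<dots> = (\<Sum>X\<in>flats A. smult (int (low_count X)) ([:- 1, 1:] ^ codim X))"
    by (intro sum.cong refl) (simp add: low_count_def of_nat_poly)
  finally show ?thesis .
qed

end

section \<open>Specialization to a very generic vector\<close>

lemma very_generic_flat_iff:
  assumes "very_generic A v" "X \<in> flats A"
  shows "X \<subseteq> {x. x \<bullet> v = 0} \<longleftrightarrow> X = bottom_flat A"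
  using assms unfolding very_generic_def generic_hyperplane_def by blast

theorem theoremA:
  fixes A :: "'a::euclidean_space set set" and v :: 'a
  assumes "arrangement A"
    and "sharp A"
    and "very_generic A v"
  shows "arr_poly A =
    (\<Sum>C\<in>{C \<in> regions A. C \<subseteq> {x. x \<bullet> v \<le> 0}}.
        monom 1 (des A (region_of A v) C))"
proof -
  have "\<exists>b. H = {x. b \<bullet> x = 0} \<and> 0 < b \<bullet> v" if H: "H \<in> A" for H
  proof -
    obtain b where b: "H = {x. b \<bullet> x = 0}"
      using assms(1) H by (auto simp: arrangement_def linear_hyperplane_def)
    have "v \<notin> H" using assms(3) H by (auto simp: very_generic_def)
    \<comment> \<open>v is off H, so one of b and -b is a normal positive on v.\<close>
    then consider "0 < b \<bullet> v" | "0 < (- b) \<bullet> v" using b by fastforce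
    then show ?thesis
    proof cases
      case 2
      moreover have "H = {x. (- b) \<bullet> x = 0}" using b by simp
      ultimately show ?thesis by blast
    qed (use b in blast)
  qed
  then obtain a where a: "\<And>H. H \<in> A \<Longrightarrow> H = {x. a H \<bullet> x = 0}" "\<And>H. H \<in> A \<Longrightarrow> 0 < a H \<bullet> v"
    by metis
  interpret based_arrangement A a v
    using assms(1) a by unfold_locales (auto simp: arrangement_def)
  interpret obtuse_arrangement A a v
    using sharp_walls_obtuse[OF assms(2)] by unfold_locales
  \<comment> \<open>The absolute value removes the two powers of -1, since \<open>low_count\<close>
    is a cardinality.\<close>
  have "arr_poly A = (\<Sum>X\<in>flats A. smult (int (low_count X)) ([:- 1, 1:] ^ codim X))"
    unfolding arr_poly_def
    using mobius_eq_low_count[OF very_generic_flat_iff[OF assms(3)]]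
    by (intro sum.cong refl) (simp add: abs_mult power_abs)
  then show ?thesis using sum_low_regions by (simp add: low_regions_def)
qed

end
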